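(* Let $(L,r)$ be a Dirac-Nijenhuis structure on $M$ and, for $n\in\mathbb{N}$, let $$L_{(n,0)}=(r^n,\mathrm{id}_{T^*M})(L),\qquad L_{(0,n)}=(\mathrm{id}_{TM},(r^* )^n)(L).$$ (1) If $\ker(r,\mathrm{id}_{T^*M})|_L=0$, then $(L_{(n,0)},r)$ is a Dirac-Nijenhuis structure for all $n\in\mathbb{N}$. (2) If $\ker(\mathrm{id}_{TM},r^* )|_L=0$, then $(L_{(0,n)},r)$ is a Dirac-Nijenhuis structure for all $n\in\mathbb{N}$.
   Context: $\mathbb{T}M=TM\oplus T^*M$ carries the pairing $\langle(X,\alpha),(Y,\beta)\rangle=\beta(X)+\alpha(Y)$ and the Courant-Dorfman bracket $[\![(X,\alpha),(Y,\beta)]\!]=([X,Y],\mathcal{L}_X\beta-i_Yd\alpha)$. A Dirac structure is a subbundle $L\subset\mathbb{T}M$ with $L=L^\perp$ whose sections are closed under the bracket. For $r\in\Omega^1(M,TM)$, viewed as $r:TM\to TM$ with dual $r^*$, set $D^r_X(Y)=[Y,r(X)]-r([Y,X])$, $D^{r,*}_X(\alpha)=\mathcal{L}_X(r^*\alpha)-\mathcal{L}_{r(X)}\alpha$, $\mathbb{D}^r_X(Y,\alpha)=(D^r_X(Y),D^{r,*}_X(\alpha))$. $L$ and $r$ are compatible if $(r,r^* )(L)\subseteq L$ and $\mathbb{D}^r_X(\Gamma(L))\subseteq\Gamma(L)$ for all $X\in\mathfrak{X}(M)$. $r$ is Nijenhuis if $[r(X),r(Y)]-r([r(X),Y]+[X,r(Y)]-r[X,Y])=0$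 for all $X,Y$. $(L,r)$ is Dirac-Nijenhuis if $L$ is Dirac, $r$ is Nijenhuis and they are compatible. Here $(A,B):\mathbb{T}M\to\mathbb{T}M$ denotes $(X,\alpha)\mapsto(A(X),B(\alpha))$ for bundle maps $A$ of $TM$ and $B$ of $T^*M$. *)

theory Defs
  imports "HOL-Analysis.Analysis"
begin

section \<open>Smooth maps and smooth manifolds\<close>

text \<open>
  \<open>Ck_on k S f\<close> is meant for open \<open>S\<close> in a finite-dimensional space, where it is
  the usual class of \<open>k\<close> times continuously differentiable maps: differentiability is required in
  the Frechet sense and every directional derivative must again be of class \<open>k - 1\<close>.
\<close>

primrec Ck_on :: "nat \<Rightarrow> 'v::real_normed_vector set \<Rightarrow> ('v \<Rightarrow> 'w::real_normed_vector) \<Rightarrow> bool" where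
  "Ck_on 0 S f \<longleftrightarrow> continuous_on S f"
| "Ck_on (Suc k) S f \<longleftrightarrow>
     (\<forall>x\<in>S. f differentiable (at x)) \<and> (\<forall>v. Ck_on k S (\<lambda>x. frechet_derivative f (at x) v))"

definition smooth_on :: "'v::real_normed_vector set \<Rightarrow> ('v \<Rightarrow> 'w::real_normed_vector) \<Rightarrow> bool" where
  "smooth_on S f \<longleftrightarrow> (\<forall>k. Ck_on k S f)"

text \<open>
  A chart is a pair of its domain and its coordinate map; values of the coordinate map outside
  the domain are irrelevant.  The manifold is the whole (Hausdorff, second countable) type
  \<open>'a\<close>, with a smooth atlas modelled on the Euclidean space \<open>'e\<close>.
\<close>

type_synonym ('a, 'e) chart = "'a set \<times> ('a \<Rightarrow> 'e)"

abbreviation chart_dom :: "('a, 'e) chart \<Rightarrow> 'a set" where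
  "chart_dom c \<equiv> fst c"

abbreviation chart_map :: "('a, 'e) chart \<Rightarrow> 'a \<Rightarrow> 'e" where
  "chart_map c \<equiv> snd c"

definition chart_inv :: "('a, 'e) chart \<Rightarrow> 'e \<Rightarrow> 'a" where
  "chart_inv c = inv_into (chart_dom c) (chart_map c)"

definition smooth_atlas ::
  "('a::{t2_space,second_countable_topology}, 'e::euclidean_space) chart set \<Rightarrow> bool" where
  "smooth_atlas A \<longleftrightarrow>
     (\<Union>c\<in>A. chart_dom c) = UNIV \<and>
     (\<forall>c\<in>A. open (chart_dom c) \<and> open (chart_map c ` chart_dom c) \<and>
        homeomorphism (chart_dom c) (chart_map c ` chart_dom c) (chart_map c) (chart_inv c)) \<and>
     (\<forall>c\<in>A. \<forall>d\<in>A. smooth_on (chart_map c ` (chart_dom c \<inter> chart_dom d)) (chart_map d \<circ> chart_inv c))"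


section \<open>Tangent and cotangent bundle\<close>

text \<open>
  For every point \<open>p\<close> one chart \<open>chart_at A p\<close> of the atlas around \<open>p\<close> is singled
  out.  A tangent vector at \<open>p\<close>, i.e. a class of pairs (chart around \<open>p\<close>, vector of
  \<open>'e\<close>) modulo the Jacobians of the coordinate changes, is stored as its representative in
  \<open>chart_at A p\<close>.  Thus the fibre of \<open>TM\<close> at \<open>p\<close> is \<open>'e\<close>, that of \<open>T*M\<close> is its dual
  \<open>'e \<Rightarrow>\<^sub>L real\<close>, and \<open>jacobian c d p\<close> converts the representative of a tangent vector at
  \<open>p\<close> in \<open>c\<close> to that in \<open>d\<close>.  Since \<open>chart_at A p\<close> may jump with \<open>p\<close>, smoothness and derivatives
  always refer to the representations \<open>vec_rep\<close>, \<open>cov_rep\<close>, \<open>endo_rep\<close> of a field in one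
  fixed chart.
\<close>

definition chart_at :: "('a, 'e) chart set \<Rightarrow> 'a \<Rightarrow> ('a, 'e) chart" where
  "chart_at A p = (SOME c. c \<in> A \<and> p \<in> chart_dom c)"

definition jacobian ::
  "('a, 'e::euclidean_space) chart \<Rightarrow> ('a, 'e) chart \<Rightarrow> 'a \<Rightarrow> 'e \<Rightarrow>\<^sub>L 'e" where
  "jacobian c d p = Blinfun (frechet_derivative (chart_map d \<circ> chart_inv c) (at (chart_map c p)))"

type_synonym ('a, 'e) vec_field = "'a \<Rightarrow> 'e"
type_synonym ('a, 'e) one_form = "'a \<Rightarrow> 'e \<Rightarrow>\<^sub>L real"
type_synonym ('a, 'e) endo_field = "'a \<Rightarrow> 'e \<Rightarrow>\<^sub>L 'e"
type_synonym 'e gen_vec = "'e \<times> ('e \<Rightarrow>\<^sub>L real)"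
type_synonym ('a, 'e) gen_section = "'a \<Rightarrow> 'e gen_vec"

definition vec_rep ::
  "('a, 'e::euclidean_space) chart set \<Rightarrow> ('a, 'e) chart \<Rightarrow> ('a, 'e) vec_field \<Rightarrow> 'e \<Rightarrow> 'e" where
  "vec_rep A c X x = (let p = chart_inv c x in jacobian (chart_at A p) c p (X p))"

definition cov_rep ::
  "('a, 'e::euclidean_space) chart set \<Rightarrow> ('a, 'e) chart \<Rightarrow> ('a, 'e) one_form \<Rightarrow> 'e \<Rightarrow> 'e \<Rightarrow>\<^sub>L real" where
  "cov_rep A c \<alpha> x = (let p = chart_inv c x in \<alpha> p o\<^sub>L jacobian c (chart_at A p) p)"

definition endo_rep ::
  "('a, 'e::euclidean_space) chart set \<Rightarrow> ('a, 'e) chart \<Rightarrow> ('a, 'e) endo_field \<Rightarrow> 'e \<Rightarrow> 'e \<Rightarrow>\<^sub>L 'e" where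
  "endo_rep A c r x = (let p = chart_inv c x in
     jacobian (chart_at A p) c p o\<^sub>L r p o\<^sub>L jacobian c (chart_at A p) p)"

definition smooth_vec_on ::
  "('a, 'e::euclidean_space) chart set \<Rightarrow> 'a set \<Rightarrow> ('a, 'e) vec_field \<Rightarrow> bool" where
  "smooth_vec_on A U X \<longleftrightarrow> (\<forall>c\<in>A. smooth_on (chart_map c ` (U \<inter> chart_dom c)) (vec_rep A c X))"

definition smooth_form_on ::
  "('a, 'e::euclidean_space) chart set \<Rightarrow> 'a set \<Rightarrow> ('a, 'e) one_form \<Rightarrow> bool" where
  "smooth_form_on A U \<alpha> \<longleftrightarrow> (\<forall>c\<in>A. smooth_on (chart_map c ` (U \<inter> chart_dom c)) (cov_rep A c \<alpha>))"

definition smooth_endo ::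
  "('a, 'e::euclidean_space) chart set \<Rightarrow> ('a, 'e) endo_field \<Rightarrow> bool" where
  "smooth_endo A r \<longleftrightarrow> (\<forall>c\<in>A. smooth_on (chart_map c ` chart_dom c) (endo_rep A c r))"

definition smooth_gen_on ::
  "('a, 'e::euclidean_space) chart set \<Rightarrow> 'a set \<Rightarrow> ('a, 'e) gen_section \<Rightarrow> bool" where
  "smooth_gen_on A U \<sigma> \<longleftrightarrow> smooth_vec_on A U (\<lambda>p. fst (\<sigma> p)) \<and> smooth_form_on A U (\<lambda>p. snd (\<sigma> p))"


section \<open>Cartan calculus\<close>

text \<open>
  All operations are given by their coordinate formulas, evaluated at \<open>p\<close> in the chart
  \<open>chart_at A p\<close> (in which a field and its representation agree at \<open>p\<close>):
  \<open>[X,Y] = DY(X) - DX(Y)\<close>, \<open>(L_X \<beta>)(v) = (D\<beta>(X))(v) + \<beta>(DX(v))\<close> and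
  \<open>d\<alpha>(u,v) = (D\<alpha>(u))(v) - (D\<alpha>(v))(u)\<close>.
\<close>

definition vec_deriv ::
  "('a, 'e::euclidean_space) chart set \<Rightarrow> ('a, 'e) vec_field \<Rightarrow> 'a \<Rightarrow> 'e \<Rightarrow> 'e" where
  "vec_deriv A X p =
     frechet_derivative (vec_rep A (chart_at A p) X) (at (chart_map (chart_at A p) p))"

definition form_deriv ::
  "('a, 'e::euclidean_space) chart set \<Rightarrow> ('a, 'e) one_form \<Rightarrow> 'a \<Rightarrow> 'e \<Rightarrow> 'e \<Rightarrow>\<^sub>L real" where
  "form_deriv A \<alpha> p =
     frechet_derivative (cov_rep A (chart_at A p) \<alpha>) (at (chart_map (chart_at A p) p))"

definition lie_bracket ::
  "('a, 'e::euclidean_space) chart set \<Rightarrow> ('a, 'e) vec_field \<Rightarrow> ('a, 'e) vec_field \<Rightarrow> ('a, 'e) vec_field" where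
  "lie_bracket A X Y p = vec_deriv A Y p (X p) - vec_deriv A X p (Y p)"

definition lie_deriv ::
  "('a, 'e::euclidean_space) chart set \<Rightarrow> ('a, 'e) vec_field \<Rightarrow> ('a, 'e) one_form \<Rightarrow> ('a, 'e) one_form" where
  "lie_deriv A X \<beta> p = Blinfun (\<lambda>v. form_deriv A \<beta> p (X p) v + \<beta> p (vec_deriv A X p v))"

definition ext_deriv ::
  "('a, 'e::euclidean_space) chart set \<Rightarrow> ('a, 'e) one_form \<Rightarrow> 'a \<Rightarrow> 'e \<Rightarrow> 'e \<Rightarrow> real" where
  "ext_deriv A \<alpha> p u v = form_deriv A \<alpha> p u v - form_deriv A \<alpha> p v u"

definition interior_prod ::
  "('a, 'e::euclidean_space) vec_field \<Rightarrow> ('a \<Rightarrow> 'e \<Rightarrow> 'e \<Rightarrow> real) \<Rightarrow> ('a, 'e) one_form" where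
  "interior_prod Y \<omega> p = Blinfun (\<lambda>v. \<omega> p (Y p) v)"


section \<open>Dirac structures\<close>

definition pairing :: "'e::euclidean_space gen_vec \<Rightarrow> 'e gen_vec \<Rightarrow> real" where
  "pairing u w = snd w (fst u) + snd u (fst w)"

definition courant_dorfman ::
  "('a, 'e::euclidean_space) chart set \<Rightarrow> ('a, 'e) gen_section \<Rightarrow> ('a, 'e) gen_section \<Rightarrow> ('a, 'e) gen_section"
where
  "courant_dorfman A \<sigma> \<tau> p =
     (let X = (\<lambda>q. fst (\<sigma> q)); \<alpha> = (\<lambda>q. snd (\<sigma> q)); Y = (\<lambda>q. fst (\<tau> q)); \<beta> = (\<lambda>q. snd (\<tau> q))
      in (lie_bracket A X Y p, lie_deriv A X \<beta> p - interior_prod Y (ext_deriv A \<alpha>) p))"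

text \<open>Smooth vector subbundle: constant rank, with smooth local frames.\<close>

definition smooth_subbundle ::
  "('a::topological_space, 'e::euclidean_space) chart set \<Rightarrow> ('a \<Rightarrow> 'e gen_vec set) \<Rightarrow> bool" where
  "smooth_subbundle A L \<longleftrightarrow>
     (\<exists>k::nat. \<forall>p. \<exists>U e. open U \<and> p \<in> U \<and> (\<forall>i<k. smooth_gen_on A U (e i)) \<and>
        (\<forall>q\<in>U. inj_on (\<lambda>i. e i q) {..<k} \<and> independent ((\<lambda>i. e i q) ` {..<k}) \<and>
               span ((\<lambda>i. e i q) ` {..<k}) = L q))"

definition sections ::
  "('a, 'e::euclidean_space) chart set \<Rightarrow> ('a \<Rightarrow> 'e gen_vec set) \<Rightarrow> ('a, 'e) gen_section set" where
  "sections A L = {\<sigma>. smooth_gen_on A UNIV \<sigma> \<and> (\<forall>p. \<sigma> p \<in> L p)}"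

definition dirac_structure ::
  "('a::topological_space, 'e::euclidean_space) chart set \<Rightarrow> ('a \<Rightarrow> 'e gen_vec set) \<Rightarrow> bool" where
  "dirac_structure A L \<longleftrightarrow>
     smooth_subbundle A L \<and>
     (\<forall>p. L p = {w. \<forall>u\<in>L p. pairing w u = 0}) \<and>
     (\<forall>\<sigma>\<in>sections A L. \<forall>\<tau>\<in>sections A L. courant_dorfman A \<sigma> \<tau> \<in> sections A L)"


section \<open>Dirac-Nijenhuis structures\<close>

definition dual_map :: "('e::euclidean_space \<Rightarrow>\<^sub>L 'e) \<Rightarrow> ('e \<Rightarrow>\<^sub>L real) \<Rightarrow> ('e \<Rightarrow>\<^sub>L real)" where
  "dual_map s \<alpha> = \<alpha> o\<^sub>L s"

definition D_vec ::
  "('a, 'e::euclidean_space) chart set \<Rightarrow> ('a, 'e) endo_field \<Rightarrow> ('a, 'e) vec_field \<Rightarrow> ('a, 'e) vec_field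
    \<Rightarrow> ('a, 'e) vec_field" where
  "D_vec A r X Y p = lie_bracket A Y (\<lambda>q. r q (X q)) p - r p (lie_bracket A Y X p)"

definition D_form ::
  "('a, 'e::euclidean_space) chart set \<Rightarrow> ('a, 'e) endo_field \<Rightarrow> ('a, 'e) vec_field \<Rightarrow> ('a, 'e) one_form
    \<Rightarrow> ('a, 'e) one_form" where
  "D_form A r X \<alpha> p =
     lie_deriv A X (\<lambda>q. dual_map (r q) (\<alpha> q)) p - lie_deriv A (\<lambda>q. r q (X q)) \<alpha> p"

definition D_gen ::
  "('a, 'e::euclidean_space) chart set \<Rightarrow> ('a, 'e) endo_field \<Rightarrow> ('a, 'e) vec_field \<Rightarrow> ('a, 'e) gen_section
    \<Rightarrow> ('a, 'e) gen_section" where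
  "D_gen A r X \<sigma> p = (D_vec A r X (\<lambda>q. fst (\<sigma> q)) p, D_form A r X (\<lambda>q. snd (\<sigma> q)) p)"

definition compatible ::
  "('a, 'e::euclidean_space) chart set \<Rightarrow> ('a \<Rightarrow> 'e gen_vec set) \<Rightarrow> ('a, 'e) endo_field \<Rightarrow> bool" where
  "compatible A L r \<longleftrightarrow>
     (\<forall>p. map_prod (r p) (dual_map (r p)) ` L p \<subseteq> L p) \<and>
     (\<forall>X. smooth_vec_on A UNIV X \<longrightarrow> D_gen A r X ` sections A L \<subseteq> sections A L)"

definition nijenhuis :: "('a, 'e::euclidean_space) chart set \<Rightarrow> ('a, 'e) endo_field \<Rightarrow> bool" where
  "nijenhuis A r \<longleftrightarrow>
     (\<forall>X Y. smooth_vec_on A UNIV X \<longrightarrow> smooth_vec_on A UNIV Y \<longrightarrow>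
       (\<forall>p. lie_bracket A (\<lambda>q. r q (X q)) (\<lambda>q. r q (Y q)) p
            - r p (lie_bracket A (\<lambda>q. r q (X q)) Y p + lie_bracket A X (\<lambda>q. r q (Y q)) p
                   - r p (lie_bracket A X Y p)) = 0))"

definition dirac_nijenhuis ::
  "('a::topological_space, 'e::euclidean_space) chart set \<Rightarrow> ('a \<Rightarrow> 'e gen_vec set) \<Rightarrow> ('a, 'e) endo_field
    \<Rightarrow> bool" where
  "dirac_nijenhuis A L r \<longleftrightarrow>
     dirac_structure A L \<and> smooth_endo A r \<and> nijenhuis A r \<and> compatible A L r"

text \<open>
  \<open>L_vec r n L\<close> and \<open>L_form r n L\<close> are the families usually written \<open>L_(n,0)\<close> and \<open>L_(0,n)\<close>.
\<close>

definition L_vec ::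
  "('a, 'e::euclidean_space) endo_field \<Rightarrow> nat \<Rightarrow> ('a \<Rightarrow> 'e gen_vec set) \<Rightarrow> 'a \<Rightarrow> 'e gen_vec set" where
  "L_vec r n L p = map_prod (blinfun_apply (r p) ^^ n) id ` L p"

definition L_form ::
  "('a, 'e::euclidean_space) endo_field \<Rightarrow> nat \<Rightarrow> ('a \<Rightarrow> 'e gen_vec set) \<Rightarrow> 'a \<Rightarrow> 'e gen_vec set" where
  "L_form r n L p = map_prod id (dual_map (r p) ^^ n) ` L p"

end

theory Submission
  imports Defs "HOL-Real_Asymp.Real_Asymp"
begin

text \<open>
  Both families arise by iterating a single bundle map, \<open>T = (r, id)\<close> in the first case and
  \<open>T = (id, r\<^sup>*)\<close> in the second.  The kernel condition passes from \<open>L\<close> to \<open>T L\<close>, because \<open>(r, r\<^sup>*)\<close>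
  preserves \<open>L\<close> and agrees with \<open>T\<close> on every \<open>w\<close> with \<open>T (T w) = 0\<close>.  So it is enough to show that
  \<open>T L\<close> is Dirac-Nijenhuis whenever \<open>T\<close> is injective on the Dirac-Nijenhuis structure \<open>L\<close>.

  The two choices of \<open>T\<close> are adjoint for the pairing and commute with product \<open>(r, r\<^sup>*)\<close>, so \<open>T L\<close>
  is isotropic.  Injectivity gives it the rank of \<open>L\<close>, which is half of the total rank, hence \<open>T L\<close>
  equals its complement (\<open>lagrangian_image\<close>).  Injectivity also shows that the smooth
  sections of \<open>T L\<close> are exactly the \<open>T \<sigma>\<close> with \<open>\<sigma>\<close> a smooth section of \<open>L\<close>
  (\<open>smooth_lift\<close>).  What remains are identities for such sections.  The operators \<open>D\<^sub>X\<close> commute with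
  \<open>T\<close> by the Nijenhuis condition, and with \<open>\<sigma> = (X, \<alpha>)\<close> the bracket satisfies

    \<open>[[T \<sigma>, T \<tau>]] = T ([[\<sigma>, (r, r\<^sup>*) \<tau>]] - D\<^sub>X \<tau>)\<close>  for \<open>T = (r, id)\<close>,

    \<open>[[T \<sigma>, T \<tau>]] = T [[\<sigma>, \<tau>]]\<close>  for \<open>T = (id, r\<^sup>*)\<close>.

  The first is the Nijenhuis condition together with a cancellation of Lie derivatives
  (\<open>dirac_nijenhuis_vec_image\<close>).  In the second the two sides differ by a covector whose value on
  \<open>Z\<close> is the pairing of \<open>D\<^sub>Z \<sigma>\<close> with \<open>\<tau>\<close>, which vanishes on \<open>L\<close>
  (\<open>dirac_nijenhuis_form_image\<close>).

  In both cases the right-hand side is \<open>T\<close> of a section of \<open>L\<close>, so its smoothness is inherited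
  from the closure conditions for \<open>L\<close>, and the identities themselves are verified at one point
  in one chart.  The analysis behind the argument is the smoothness of coefficients in a frame
  (\<open>smooth_coefficients\<close>) and the extension of a tangent vector to a global vector field by a
  bump function (\<open>vec_extension\<close>).
\<close>

section \<open>Calculus of smooth maps on open sets\<close>

lemma Ck_on_subset: "Ck_on k S f \<Longrightarrow> T \<subseteq> S \<Longrightarrow> Ck_on k T f"
  by (induction k arbitrary: f) (auto intro: continuous_on_subset)

lemma Ck_on_SucD: "Ck_on (Suc k) S f \<Longrightarrow> Ck_on k S f"
proof (induction k arbitrary: f)
  case 0
  then show ?case
    by (auto intro!: continuous_at_imp_continuous_on differentiable_imp_continuous_within)
next
  case (Suc k)
  then show ?case by (metis Ck_on.simps(2))
qed

lemma frechet_derivative_cong_open: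
  assumes "open S" "x \<in> S" "\<And>y. y \<in> S \<Longrightarrow> f y = g y"
  shows "frechet_derivative f (at x) = frechet_derivative g (at x)"
proof -
  have "(f has_derivative D) (at x) \<longleftrightarrow> (g has_derivative D) (at x)" for D
    using assms has_derivative_transform_within_open[of f D x UNIV S g]
      has_derivative_transform_within_open[of g D x UNIV S f] by auto
  then show ?thesis unfolding frechet_derivative_def by simp
qed

lemma differentiable_cong_open:
  assumes "f differentiable (at x)" "open S" "x \<in> S" "\<And>y. y \<in> S \<Longrightarrow> f y = g y"
  shows "g differentiable (at x)"
  using assms has_derivative_transform_within_open[of f _ x UNIV S g]
  unfolding differentiable_def by blast

text \<open>
  Only the values on the open set \<open>S\<close> matter, although the derivatives in \<open>Ck_on\<close> are taken with
  respect to the whole space: at a point of an open set they are determined by the values there.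
  Through this lemma a computed derivative, valid on \<open>S\<close> only, may replace the one in the
  definition.
\<close>

lemma Ck_on_cong:
  assumes "open S" "\<And>x. x \<in> S \<Longrightarrow> f x = g x" "Ck_on k S f"
  shows "Ck_on k S g"
  using assms(2,3)
proof (induction k arbitrary: f g)
  case 0
  then show ?case using continuous_on_cong[of S S f g] by simp
next
  case (Suc k)
  have "Ck_on k S (\<lambda>x. frechet_derivative g (at x) v)" for v
    by (rule Suc.IH[of "\<lambda>x. frechet_derivative f (at x) v"])
       (use Suc.prems frechet_derivative_cong_open[OF assms(1), of _ f g] in auto)
  then show ?case
    using Suc.prems differentiable_cong_open[of f _ S g] assms(1) by auto
qed

lemma Ck_on_open_local:
  assumes "\<And>x. x \<in> S \<Longrightarrow> \<exists>T. open T \<and> x \<in> T \<and> Ck_on k T f"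
  shows "Ck_on k S f"
  using assms
proof (induction k arbitrary: f)
  case 0
  then show ?case
    by (metis Ck_on.simps(1) continuous_at_imp_continuous_on continuous_on_eq_continuous_at)
next
  case (Suc k)
  have "Ck_on k S (\<lambda>x. frechet_derivative f (at x) v)" for v
    by (rule Suc.IH) (use Suc.prems in fastforce)
  moreover have "f differentiable (at x)" if "x \<in> S" for x
    using Suc.prems[OF that] by auto
  ultimately show ?case by simp
qed

lemma Ck_on_const: "Ck_on k S (\<lambda>x. c)"
  by (induction k arbitrary: c) auto

lemma Ck_on_SucI:
  assumes "open S" "\<And>x. x \<in> S \<Longrightarrow> (f has_derivative D x) (at x)" "\<And>v. Ck_on k S (\<lambda>x. D x v)"
  shows "Ck_on (Suc k) S f"
proof -
  have eq: "D x = frechet_derivative f (at x)" if "x \<in> S" for x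
    using frechet_derivative_at[OF assms(2)[OF that]] .
  have "Ck_on k S (\<lambda>x. frechet_derivative f (at x) v)" for v
    by (rule Ck_on_cong[OF assms(1) _ assms(3)[of v]]) (simp add: eq)
  then show ?thesis using assms(2) by (auto simp: differentiable_def)
qed

lemma Ck_on_has_derivative:
  "Ck_on (Suc k) S f \<Longrightarrow> x \<in> S \<Longrightarrow> (f has_derivative frechet_derivative f (at x)) (at x)"
  by (simp add: frechet_derivative_works)

lemma Ck_on_add:
  assumes "open S" "Ck_on k S f" "Ck_on k S g"
  shows "Ck_on k S (\<lambda>x. f x + g x)"
  using assms(2,3)
proof (induction k arbitrary: f g)
  case 0
  then show ?case by (auto intro: continuous_intros)
next
  case (Suc k)
  show ?case
    by (rule Ck_on_SucI[OF assms(1)])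
       (use Suc in \<open>auto intro!: derivative_eq_intros Ck_on_has_derivative simp del: Ck_on.simps(2)\<close>, use Suc in auto)
qed

lemma Ck_on_bounded_linear:
  assumes "open S" "bounded_linear h" "Ck_on k S f"
  shows "Ck_on k S (\<lambda>x. h (f x))"
  using assms(3)
proof (induction k arbitrary: f)
  case 0
  then show ?case using assms(2) by (auto intro: bounded_linear.continuous_on)
next
  case (Suc k)
  show ?case
  proof (rule Ck_on_SucI[OF assms(1)])
    show "((\<lambda>x. h (f x)) has_derivative (\<lambda>v. h (frechet_derivative f (at x) v))) (at x)" if "x \<in> S" for x
      using bounded_linear.has_derivative[OF assms(2) Ck_on_has_derivative[OF Suc.prems that]] .
  qed (use Suc in auto)
qed

lemma Ck_on_bounded_bilinear:
  assumes "open S" "bounded_bilinear h" "Ck_on k S f" "Ck_on k S g"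
  shows "Ck_on k S (\<lambda>x. h (f x) (g x))"
  using assms(3,4)
proof (induction k arbitrary: f g)
  case 0
  then show ?case using assms(2) by (auto intro: bounded_bilinear.continuous_on)
next
  case (Suc k)
  show ?case
  proof (rule Ck_on_SucI[OF assms(1)])
    show "((\<lambda>x. h (f x) (g x)) has_derivative
       (\<lambda>v. h (f x) (frechet_derivative g (at x) v) + h (frechet_derivative f (at x) v) (g x))) (at x)"
      if "x \<in> S" for x
      using bounded_bilinear.FDERIV[OF assms(2) Ck_on_has_derivative[OF Suc.prems(1) that]
          Ck_on_has_derivative[OF Suc.prems(2) that]] .
    show "Ck_on k S (\<lambda>x. h (f x) (frechet_derivative g (at x) v) + h (frechet_derivative f (at x) v) (g x))" for v
      using Suc.prems by (intro Ck_on_add[OF assms(1)] Suc.IH) (auto intro: Ck_on_SucD)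
  qed
qed

text \<open>
  The derivative of \<open>1/f\<close> is \<open>- Df / f\<^sup>2\<close>, in which \<open>1/f\<close> itself is of class \<open>C\<^sup>k\<close> by
  induction.
\<close>

lemma Ck_on_inverse:
  fixes f :: "'v::real_normed_vector \<Rightarrow> real"
  assumes "open S" "\<And>x. x \<in> S \<Longrightarrow> f x \<noteq> 0" "Ck_on k S f"
  shows "Ck_on k S (\<lambda>x. inverse (f x))"
  using assms(3)
proof (induction k)
  case 0
  then show ?case using assms(2) by (auto intro: continuous_intros)
next
  case (Suc k)
  note mult = Ck_on_bounded_bilinear[OF assms(1) bounded_bilinear_mult]
  have inv: "Ck_on k S (\<lambda>x. inverse (f x))" using Suc Ck_on_SucD by blast
  show ?case
  proof (rule Ck_on_SucI[OF assms(1)])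
    show "((\<lambda>x. inverse (f x)) has_derivative
       (\<lambda>v. - (inverse (f x) * frechet_derivative f (at x) v * inverse (f x)))) (at x)"
      if "x \<in> S" for x
      using Deriv.has_derivative_inverse[OF assms(2)[OF that] Ck_on_has_derivative[OF Suc.prems that]] .
    show "Ck_on k S (\<lambda>x. - (inverse (f x) * frechet_derivative f (at x) v * inverse (f x)))" for v
      using Suc.prems
      by (intro Ck_on_bounded_linear[OF assms(1) bounded_linear_minus[OF bounded_linear_ident]] mult inv) auto
  qed
qed

lemma Ck_on_sum:
  assumes "open S" "\<And>i. i \<in> I \<Longrightarrow> Ck_on k S (f i)"
  shows "Ck_on k S (\<lambda>x. \<Sum>i\<in>I. f i x)"
  using assms(2)
  by (induction I rule: infinite_finite_induct) (auto intro: Ck_on_const Ck_on_add[OF assms(1)])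

text \<open>
  Since \<open>Ck_on\<close> speaks of directional derivatives with a constant direction only, the chain
  rule is expanded in a basis of the middle space, \<open>D(f \<circ> g)(x) v = \<Sum>b. (Dg(x) v \<bullet> b) D\<^sub>bf(g x)\<close>,
  which is a sum of products of \<open>C\<^sup>k\<close> functions by induction.
\<close>

lemma Ck_on_compose:
  fixes g :: "'v::real_normed_vector \<Rightarrow> 'w::euclidean_space"
  assumes "open S" "open T" "g ` S \<subseteq> T" "Ck_on k S g" "Ck_on k T f"
  shows "Ck_on k S (\<lambda>x. f (g x))"
  using assms(4,5)
proof (induction k arbitrary: f)
  case 0
  then show ?case using assms(3) by (auto intro: continuous_on_compose2)
next
  case (Suc k)
  let ?Dg = "\<lambda>x. frechet_derivative g (at x)" and ?Df = "\<lambda>x. frechet_derivative f (at x)"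
  show ?case
  proof (rule Ck_on_SucI[OF assms(1)])
    fix x assume x: "x \<in> S"
    have df: "(f has_derivative ?Df (g x)) (at (g x))"
      using Ck_on_has_derivative[OF Suc.prems(2)] x assms(3) by blast
    have chain: "((\<lambda>x. f (g x)) has_derivative (\<lambda>v. ?Df (g x) (?Dg x v))) (at x)"
      using has_derivative_compose[OF Ck_on_has_derivative[OF Suc.prems(1) x] df] .
    have basis: "?Df (g x) w = (\<Sum>b\<in>Basis. (w \<bullet> b) *\<^sub>R ?Df (g x) b)" for w
    proof -
      have lin: "linear (?Df (g x))" using df has_derivative_linear by blast
      have "?Df (g x) w = ?Df (g x) (\<Sum>b\<in>Basis. (w \<bullet> b) *\<^sub>R b)" by (simp add: euclidean_representation)
      then show ?thesis using lin by (simp add: linear_sum linear_cmul)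
    qed
    show "((\<lambda>x. f (g x)) has_derivative
        (\<lambda>v. \<Sum>b\<in>Basis. (?Dg x v \<bullet> b) *\<^sub>R ?Df (g x) b)) (at x)"
      by (rule has_derivative_eq_rhs[OF chain]) (rule ext, rule basis)
  next
    fix v
    have "Ck_on k S (\<lambda>x. ?Df (g x) b)" for b
      using Suc.IH[of "\<lambda>y. ?Df y b"] Suc.prems Ck_on_SucD by auto
    moreover have "Ck_on k S (\<lambda>x. ?Dg x v \<bullet> b)" for b
      using Suc.prems by (intro Ck_on_bounded_linear[OF assms(1) bounded_linear_inner_left]) auto
    ultimately show "Ck_on k S (\<lambda>x. \<Sum>b\<in>Basis. (?Dg x v \<bullet> b) *\<^sub>R ?Df (g x) b)"
      by (intro Ck_on_sum[OF assms(1)] Ck_on_bounded_bilinear[OF assms(1) bounded_bilinear_scaleR])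
  qed
qed

lemma smooth_on_subset: "smooth_on S f \<Longrightarrow> T \<subseteq> S \<Longrightarrow> smooth_on T f"
  unfolding smooth_on_def using Ck_on_subset by blast

lemma smooth_on_cong: "open S \<Longrightarrow> (\<And>x. x \<in> S \<Longrightarrow> f x = g x) \<Longrightarrow> smooth_on S f \<Longrightarrow> smooth_on S g"
  unfolding smooth_on_def using Ck_on_cong by blast

lemma smooth_on_open_local:
  "(\<And>x. x \<in> S \<Longrightarrow> \<exists>T. open T \<and> x \<in> T \<and> smooth_on T f) \<Longrightarrow> smooth_on S f"
  unfolding smooth_on_def by (metis Ck_on_open_local)

lemma smooth_on_differentiable: "smooth_on S f \<Longrightarrow> x \<in> S \<Longrightarrow> f differentiable (at x)"
  unfolding smooth_on_def by (metis Ck_on.simps(2))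

lemma smooth_on_directional_derivative:
  "smooth_on S f \<Longrightarrow> smooth_on S (\<lambda>x. frechet_derivative f (at x) v)"
  unfolding smooth_on_def by (metis Ck_on.simps(2))

lemma smooth_on_const: "smooth_on S (\<lambda>x. c)"
  unfolding smooth_on_def using Ck_on_const by blast

lemma smooth_on_id: "open S \<Longrightarrow> smooth_on S (\<lambda>x. x)"
  unfolding smooth_on_def
proof
  fix k assume S: "open S"
  have "Ck_on (Suc k) S (\<lambda>x. x)"
    by (rule Ck_on_SucI[OF S has_derivative_ident]) (rule Ck_on_const)
  then show "Ck_on k S (\<lambda>x. x)" by (rule Ck_on_SucD)
qed

lemma smooth_on_add:
  "open S \<Longrightarrow> smooth_on S f \<Longrightarrow> smooth_on S g \<Longrightarrow> smooth_on S (\<lambda>x. f x + g x)"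
  unfolding smooth_on_def using Ck_on_add by blast

lemma smooth_on_bounded_linear:
  "open S \<Longrightarrow> bounded_linear h \<Longrightarrow> smooth_on S f \<Longrightarrow> smooth_on S (\<lambda>x. h (f x))"
  unfolding smooth_on_def using Ck_on_bounded_linear by blast

lemma smooth_on_bounded_bilinear:
  "open S \<Longrightarrow> bounded_bilinear h \<Longrightarrow> smooth_on S f \<Longrightarrow> smooth_on S g \<Longrightarrow> smooth_on S (\<lambda>x. h (f x) (g x))"
  unfolding smooth_on_def using Ck_on_bounded_bilinear by blast

lemma smooth_on_scaleR:
  "open S \<Longrightarrow> smooth_on S f \<Longrightarrow> smooth_on S g \<Longrightarrow> smooth_on S (\<lambda>x. f x *\<^sub>R g x)"
  by (rule smooth_on_bounded_bilinear[OF _ bounded_bilinear_scaleR])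

lemma smooth_on_diff:
  assumes "open S" "smooth_on S f" "smooth_on S g"
  shows "smooth_on S (\<lambda>x. f x - g x)"
  using smooth_on_add[OF assms(1,2)
      smooth_on_bounded_linear[OF assms(1) bounded_linear_minus[OF bounded_linear_ident] assms(3)]] by simp

lemma smooth_on_inverse:
  fixes f :: "'v::real_normed_vector \<Rightarrow> real"
  shows "open S \<Longrightarrow> (\<And>x. x \<in> S \<Longrightarrow> f x \<noteq> 0) \<Longrightarrow> smooth_on S f \<Longrightarrow> smooth_on S (\<lambda>x. inverse (f x))"
  unfolding smooth_on_def using Ck_on_inverse by blast

lemma smooth_on_sum:
  "open S \<Longrightarrow> (\<And>i. i \<in> I \<Longrightarrow> smooth_on S (f i)) \<Longrightarrow> smooth_on S (\<lambda>x. \<Sum>i\<in>I. f i x)"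
  unfolding smooth_on_def by (auto intro!: Ck_on_sum)

lemma smooth_on_compose:
  fixes g :: "'v::real_normed_vector \<Rightarrow> 'w::euclidean_space"
  shows "open S \<Longrightarrow> open T \<Longrightarrow> g ` S \<subseteq> T \<Longrightarrow> smooth_on S g \<Longrightarrow> smooth_on T f \<Longrightarrow> smooth_on S (\<lambda>x. f (g x))"
  unfolding smooth_on_def using Ck_on_compose by blast

lemma smooth_on_Pair_iff:
  assumes "open S"
  shows "smooth_on S (\<lambda>x. (f x, g x)) \<longleftrightarrow> smooth_on S f \<and> smooth_on S g"
proof
  assume fg: "smooth_on S (\<lambda>x. (f x, g x))"
  show "smooth_on S f \<and> smooth_on S g"
    using smooth_on_bounded_linear[OF assms bounded_linear_fst fg]
      smooth_on_bounded_linear[OF assms bounded_linear_snd fg] by simp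
next
  assume "smooth_on S f \<and> smooth_on S g"
  then have "smooth_on S (\<lambda>x. (f x, 0) + (0, g x))"
    by (intro smooth_on_add assms
        smooth_on_bounded_linear[OF assms bounded_linear_Pair[OF bounded_linear_ident bounded_linear_zero]]
        smooth_on_bounded_linear[OF assms bounded_linear_Pair[OF bounded_linear_zero bounded_linear_ident]]) auto
  then show "smooth_on S (\<lambda>x. (f x, g x))" by simp
qed

section \<open>Coefficients with respect to a smooth frame\<close>

text \<open>
  The frame vectors are eliminated one at a time.  The projection \<open>P\<close> along
  the last vector \<open>F k\<close> onto its orthogonal complement depends smoothly on the point, kills
  \<open>F k\<close> and keeps the other vectors independent, so the first \<open>k\<close> coefficients are smooth by
  induction.  What is left of the sum is a multiple of \<open>F k\<close>, whose factor is an inner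
  product divided by \<open>F k \<bullet> F k\<close>.
\<close>

lemma smooth_coefficients:
  fixes F :: "nat \<Rightarrow> 'v::real_normed_vector \<Rightarrow> 'w::real_inner"
  assumes "open S"
    and "\<And>i. i < k \<Longrightarrow> smooth_on S (F i)"
    and "\<And>x a. x \<in> S \<Longrightarrow> (\<Sum>i<k. a i *\<^sub>R F i x) = 0 \<Longrightarrow> \<forall>i<k. a i = 0"
    and "smooth_on S (\<lambda>x. \<Sum>i<k. c i x *\<^sub>R F i x)"
  shows "\<forall>i<k. smooth_on S (c i)"
  using assms(2-)
proof (induction k arbitrary: F)
  case 0
  then show ?case by simp
next
  case (Suc k)
  define N where "N x = inverse (F k x \<bullet> F k x)" for x
  define P where "P x w = w - (N x * (w \<bullet> F k x)) *\<^sub>R F k x" for x w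
  note inner = smooth_on_bounded_bilinear[OF assms(1) bounded_bilinear_inner]
  note mult = smooth_on_bounded_bilinear[OF assms(1) bounded_bilinear_mult]
  have Fk: "F k x \<noteq> 0" if "x \<in> S" for x
    using Suc.prems(2)[OF that, of "\<lambda>i. if i = k then 1 else 0"] by fastforce
  have N: "smooth_on S N" unfolding N_def
    using Fk Suc.prems(1) by (intro smooth_on_inverse[OF assms(1)] inner) auto
  have P_smooth: "smooth_on S (\<lambda>x. P x (G x))" if "smooth_on S G" for G
    unfolding P_def using that Suc.prems(1)
    by (intro smooth_on_diff smooth_on_scaleR mult inner N assms(1)) auto
  have P_sum: "P x (\<Sum>i<m. a i *\<^sub>R G i) = (\<Sum>i<m. a i *\<^sub>R P x (G i))" for x a m and G :: "nat \<Rightarrow> 'w"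
    by (simp add: P_def inner_sum_left sum_distrib_left scaleR_sum_left scaleR_diff_right
        sum_subtractf algebra_simps)
  have P_Fk: "P x (F k x) = 0" if "x \<in> S" for x
    using Fk[OF that] by (simp add: P_def N_def)
  have first: "\<forall>i<k. smooth_on S (c i)"
  proof (rule Suc.IH[of "\<lambda>i x. P x (F i x)"])
    show "smooth_on S (\<lambda>x. P x (F i x))" if "i < k" for i
      using Suc.prems(1) that by (intro P_smooth) auto
    show "\<forall>i<k. a i = 0" if x: "x \<in> S" and "(\<Sum>i<k. a i *\<^sub>R P x (F i x)) = 0" for x a
    proof -
      let ?w = "\<Sum>i<k. a i *\<^sub>R F i x"
      \<comment> \<open>\<open>P\<close> kills exactly the multiples of \<open>F k x\<close>, so the sum is one of them.\<close>
      define t where "t = N x * (?w \<bullet> F k x)"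
      have "P x ?w = 0" using that(2) by (simp add: P_sum)
      then have "?w - t *\<^sub>R F k x = 0" by (simp add: P_def t_def)
      then have "(\<Sum>i<Suc k. (if i = k then - t else a i) *\<^sub>R F i x) = 0" by simp
      from Suc.prems(2)[OF x this] show ?thesis by (metis less_Suc_eq nat_neq_iff)
    qed
    have "smooth_on S (\<lambda>x. P x (\<Sum>i<Suc k. c i x *\<^sub>R F i x))"
      by (intro P_smooth Suc.prems(3))
    then show "smooth_on S (\<lambda>x. \<Sum>i<k. c i x *\<^sub>R P x (F i x))"
      by (rule smooth_on_cong[OF assms(1), rotated]) (simp only: P_sum, simp add: P_Fk)
  qed
  have rest: "smooth_on S (\<lambda>x. \<Sum>i<k. c i x *\<^sub>R F i x)"
    using first Suc.prems(1) by (intro smooth_on_sum smooth_on_scaleR assms(1)) auto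
  have "smooth_on S (\<lambda>x. N x * (((\<Sum>i<Suc k. c i x *\<^sub>R F i x) - (\<Sum>i<k. c i x *\<^sub>R F i x)) \<bullet> F k x))"
    by (rule mult[OF N inner[OF smooth_on_diff[OF assms(1) Suc.prems(3) rest] Suc.prems(1)]]) simp
  then have "smooth_on S (c k)"
    by (rule smooth_on_cong[OF assms(1), rotated]) (use Fk in \<open>simp add: N_def\<close>)
  with first show ?case by (simp add: less_Suc_eq)
qed

section \<open>A smooth bump function\<close>

text \<open>
  The function \<open>exp (-1/t)\<close>, extended by \<open>0\<close> to the half-line \<open>t \<le> 0\<close>, is the case
  \<open>m = 0\<close>.  The factors \<open>(1/t)\<^sup>m\<close> make the family, up to linear combinations, closed under
  differentiation, so that smoothness can be proved for all members at once.
\<close>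

definition flat_exp :: "nat \<Rightarrow> real \<Rightarrow> real" where
  "flat_exp m t = (if t > 0 then (1 / t) ^ m * exp (- (1 / t)) else 0)"

lemma flat_exp_tendsto: "(flat_exp m \<longlongrightarrow> 0) (at 0)"
proof -
  have "((\<lambda>t::real. (1 / t) ^ m * exp (- (1 / t))) \<longlongrightarrow> 0) (at_right 0)"
    by real_asymp
  then have "(flat_exp m \<longlongrightarrow> 0) (at_right 0)"
    by (rule Lim_transform_eventually)
       (auto simp: flat_exp_def eventually_at_right_field intro!: exI[of _ 1])
  moreover have "(flat_exp m \<longlongrightarrow> 0) (at_left 0)"
    by (rule Lim_transform_eventually[OF tendsto_const])
       (auto simp: flat_exp_def eventually_at_left_field intro!: exI[of _ "-1"])
  ultimately show ?thesis by (simp add: filterlim_split_at)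
qed

lemma flat_exp_has_derivative:
  "(flat_exp m has_field_derivative (flat_exp (m + 2) t - real m * flat_exp (m + 1) t)) (at t)"
proof -
  consider "t > 0" | "t = 0" | "t < 0" by linarith
  then show ?thesis
  proof cases
    case 1
    have "((\<lambda>t. (1 / t) ^ m * exp (- (1 / t))) has_field_derivative
        (flat_exp (m + 2) t - real m * flat_exp (m + 1) t)) (at t)"
    proof -
      have "((\<lambda>u::real. u ^ m * exp (- u)) has_field_derivative
          real m * (1 / t) ^ (m - 1) * exp (- (1 / t)) - (1 / t) ^ m * exp (- (1 / t))) (at (1 / t))"
        by (auto intro!: derivative_eq_intros)
      moreover have "((\<lambda>t. 1 / t) has_field_derivative - ((1 / t) ^ 2)) (at t)"
        using 1 by (auto intro!: derivative_eq_intros simp: power2_eq_square)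
      ultimately have "((\<lambda>t. (1 / t) ^ m * exp (- (1 / t))) has_field_derivative
          (real m * (1 / t) ^ (m - 1) * exp (- (1 / t)) - (1 / t) ^ m * exp (- (1 / t))) * - ((1 / t) ^ 2)) (at t)"
        by (rule DERIV_chain2)
      moreover have "(real m * u ^ (m - 1) * e - u ^ m * e) * - (u ^ 2) =
          u ^ (m + 2) * e - real m * (u ^ (m + 1) * e)" for u e :: real
        by (cases m) (simp_all add: algebra_simps power2_eq_square)
      ultimately show ?thesis using 1 by (simp add: flat_exp_def)
    qed
    then show ?thesis
      by (rule has_field_derivative_transform_within_open[of _ _ _ "{0<..}"])
         (use 1 in \<open>auto simp: flat_exp_def\<close>)
  next
    case 2
    \<comment> \<open>The difference quotient at 0 is the next member of the family, which tends to 0.\<close>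
    have "((\<lambda>h. (flat_exp m (0 + h) - flat_exp m 0) / h) \<longlongrightarrow> 0) (at 0)"
      by (rule Lim_transform_eventually[OF flat_exp_tendsto[of "Suc m"]])
         (auto simp: flat_exp_def)
    then show ?thesis using 2 by (simp add: DERIV_def flat_exp_def)
  next
    case 3
    have "((\<lambda>t. 0) has_field_derivative (flat_exp (m + 2) t - real m * flat_exp (m + 1) t)) (at t)"
      using 3 by (simp add: flat_exp_def)
    then show ?thesis
      by (rule has_field_derivative_transform_within_open[of _ _ _ "{..<0}"])
         (use 3 in \<open>auto simp: flat_exp_def\<close>)
  qed
qed

lemma flat_exp_smooth: "smooth_on UNIV (flat_exp m)"
  unfolding smooth_on_def
proof
  fix k show "Ck_on k UNIV (flat_exp m)"
  proof (induction k arbitrary: m)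
    case 0
    have "continuous (at t) (flat_exp m)" for t
      using flat_exp_has_derivative DERIV_isCont by blast
    then show ?case by (simp add: continuous_at_imp_continuous_on)
  next
    case (Suc k)
    let ?D = "\<lambda>t. flat_exp (m + 2) t - real m * flat_exp (m + 1) t"
    show ?case
    proof (rule Ck_on_SucI)
      show "(flat_exp m has_derivative (\<lambda>v. ?D t * v)) (at t)" for t
        using flat_exp_has_derivative[of m t] by (simp add: has_field_derivative_def)
      have "Ck_on k UNIV (\<lambda>t. v * flat_exp (m + 2) t + (- (v * real m)) * flat_exp (m + 1) t)" for v
        by (intro Ck_on_add Ck_on_bounded_linear[OF _ bounded_linear_mult_right] Suc) auto
      then show "Ck_on k UNIV (\<lambda>t. ?D t * v)" for v by (simp add: algebra_simps)
    qed simp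
  qed
qed

text \<open>
  Radial profile: \<open>exp (-1/t)\<close> at \<open>t = R\<^sup>2 - |y - y\<^sub>0|\<^sup>2\<close>, normalised at the centre.
\<close>

lemma smooth_bump:
  fixes y0 :: "'e::euclidean_space"
  assumes "R > 0"
  obtains \<phi> :: "'e \<Rightarrow> real" where "smooth_on UNIV \<phi>" "\<phi> y0 = 1" "\<And>y. y \<notin> ball y0 R \<Longrightarrow> \<phi> y = 0"
proof
  define \<psi> :: "'e \<Rightarrow> real" where "\<psi> y = flat_exp 0 (R\<^sup>2 - (y - y0) \<bullet> (y - y0))" for y
  let ?\<phi> = "\<lambda>y. inverse (\<psi> y0) *\<^sub>R \<psi> y"
  have "smooth_on UNIV \<psi>" unfolding \<psi>_def
    by (rule smooth_on_compose[OF _ _ _ _ flat_exp_smooth])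
       (auto intro!: smooth_on_diff smooth_on_const smooth_on_id
          smooth_on_bounded_bilinear[OF _ bounded_bilinear_inner])
  then show "smooth_on UNIV ?\<phi>"
    by (intro smooth_on_scaleR smooth_on_const) auto
  show "?\<phi> y0 = 1" using assms by (simp add: \<psi>_def flat_exp_def)
  show "?\<phi> y = 0" if "y \<notin> ball y0 R" for y
  proof -
    have "R\<^sup>2 \<le> (norm (y - y0))\<^sup>2"
      using that assms by (intro power_mono) (auto simp: dist_norm norm_minus_commute)
    then show ?thesis by (simp add: \<psi>_def flat_exp_def dot_square_norm)
  qed
qed

section \<open>Coordinate representations on a manifold\<close>

context
  fixes A :: "('a::{t2_space,second_countable_topology}, 'e::euclidean_space) chart set"
  assumes atlas: "smooth_atlas A"
begin

lemma chart_at_in_atlas: "chart_at A p \<in> A" and chart_at_covers: "p \<in> chart_dom (chart_at A p)"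
proof -
  have "\<exists>c. c \<in> A \<and> p \<in> chart_dom c" using atlas unfolding smooth_atlas_def by blast
  from someI_ex[OF this] show "chart_at A p \<in> A" "p \<in> chart_dom (chart_at A p)"
    by (auto simp: chart_at_def)
qed

lemma open_chart_dom: "c \<in> A \<Longrightarrow> open (chart_dom c)"
  using atlas unfolding smooth_atlas_def by blast

lemma chart_homeomorphism:
  "c \<in> A \<Longrightarrow> homeomorphism (chart_dom c) (chart_map c ` chart_dom c) (chart_map c) (chart_inv c)"
  using atlas unfolding smooth_atlas_def by blast

lemma chart_inv_chart_map: "c \<in> A \<Longrightarrow> p \<in> chart_dom c \<Longrightarrow> chart_inv c (chart_map c p) = p"
  using chart_homeomorphism homeomorphism_apply1 by metis

lemma open_chart_image:
  assumes "c \<in> A" "open U"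
  shows "open (chart_map c ` (U \<inter> chart_dom c))"
proof -
  have "openin (top_of_set (chart_dom c)) (U \<inter> chart_dom c)"
    using assms(2) by (auto simp: openin_open)
  then have "openin (top_of_set (chart_map c ` chart_dom c)) (chart_map c ` (U \<inter> chart_dom c))"
    by (rule homeomorphism_imp_open_map[OF chart_homeomorphism[OF assms(1)]])
  moreover have "open (chart_map c ` chart_dom c)"
    using atlas assms(1) unfolding smooth_atlas_def by blast
  ultimately show ?thesis using openin_open_trans by blast
qed

lemma transition_smooth:
  "c \<in> A \<Longrightarrow> d \<in> A \<Longrightarrow>
    smooth_on (chart_map c ` (chart_dom c \<inter> chart_dom d)) (chart_map d \<circ> chart_inv c)"
  using atlas unfolding smooth_atlas_def by blast

lemma transition_has_derivative:
  assumes "c \<in> A" "d \<in> A" "p \<in> chart_dom c" "p \<in> chart_dom d"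
  shows "((chart_map d \<circ> chart_inv c) has_derivative jacobian c d p) (at (chart_map c p))"
proof -
  have "(chart_map d \<circ> chart_inv c) differentiable (at (chart_map c p))"
    using smooth_on_differentiable[OF transition_smooth[OF assms(1,2)]] assms(3,4) by blast
  then have D: "((chart_map d \<circ> chart_inv c) has_derivative
      frechet_derivative (chart_map d \<circ> chart_inv c) (at (chart_map c p))) (at (chart_map c p))"
    by (simp add: frechet_derivative_works)
  then show ?thesis
    by (simp add: jacobian_def bounded_linear_Blinfun_apply has_derivative_bounded_linear)
qed

text \<open>
  Chain rule for the coordinate changes from \<open>c\<close> over \<open>d\<close> to \<open>e\<close>, which compose on a
  neighbourhood of the point.  It is what makes the representations in a fixed chart insensitive to
  the jumps of \<open>chart_at A p\<close>.
\<close>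

lemma jacobian_cocycle:
  assumes "c \<in> A" "d \<in> A" "e \<in> A" "p \<in> chart_dom c" "p \<in> chart_dom d" "p \<in> chart_dom e"
  shows "jacobian d e p (jacobian c d p v) = jacobian c e p v"
proof -
  let ?W = "chart_map c ` ((chart_dom d \<inter> chart_dom e) \<inter> chart_dom c)"
  have "((\<lambda>x. (chart_map e \<circ> chart_inv d) ((chart_map d \<circ> chart_inv c) x)) has_derivative
      (\<lambda>v. jacobian d e p (jacobian c d p v))) (at (chart_map c p))"
    by (rule has_derivative_compose[OF transition_has_derivative[OF assms(1,2,4,5)]])
       (use transition_has_derivative[OF assms(2,3,5,6)] in \<open>simp add: chart_inv_chart_map assms o_def\<close>)
  then have "((chart_map e \<circ> chart_inv c) has_derivative
      (\<lambda>v. jacobian d e p (jacobian c d p v))) (at (chart_map c p))"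
  proof (rule has_derivative_transform_within_open)
    show "open ?W" by (intro open_chart_image open_Int open_chart_dom assms)
  qed (use assms in \<open>auto simp: chart_inv_chart_map\<close>)
  from has_derivative_unique[OF this transition_has_derivative[OF assms(1,3,4,6)]]
  show ?thesis by metis
qed

lemma jacobian_self:
  assumes "c \<in> A" "p \<in> chart_dom c"
  shows "jacobian c c p v = v"
proof -
  have "((\<lambda>x. x) has_derivative (\<lambda>v. v)) (at (chart_map c p))" by simp
  then have "((chart_map c \<circ> chart_inv c) has_derivative (\<lambda>v. v)) (at (chart_map c p))"
  proof (rule has_derivative_transform_within_open)
    show "open (chart_map c ` (UNIV \<inter> chart_dom c))" by (intro open_chart_image assms) simp
  qed (use assms in \<open>auto simp: chart_inv_chart_map\<close>)
  from has_derivative_unique[OF this transition_has_derivative[OF assms(1,1,2,2)]]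
  show ?thesis by metis
qed

lemma jacobian_inverse:
  assumes "c \<in> A" "p \<in> chart_dom c"
  shows "jacobian c (chart_at A p) p (jacobian (chart_at A p) c p v) = v"
    and "jacobian (chart_at A p) c p (jacobian c (chart_at A p) p v) = v"
  using jacobian_cocycle[OF chart_at_in_atlas assms(1) chart_at_in_atlas chart_at_covers assms(2) chart_at_covers]
    jacobian_cocycle[OF assms(1) chart_at_in_atlas assms(1,2) chart_at_covers assms(2)]
    jacobian_self[OF assms] jacobian_self[OF chart_at_in_atlas chart_at_covers] by auto

lemma vec_rep_chart_at: "vec_rep A (chart_at A p) X (chart_map (chart_at A p) p) = X p"
  by (simp add: vec_rep_def chart_inv_chart_map[OF chart_at_in_atlas chart_at_covers]
      jacobian_self[OF chart_at_in_atlas chart_at_covers])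

lemma cov_rep_chart_at: "cov_rep A (chart_at A p) \<alpha> (chart_map (chart_at A p) p) = \<alpha> p"
  by (rule blinfun_eqI) (simp add: cov_rep_def chart_inv_chart_map[OF chart_at_in_atlas chart_at_covers]
      jacobian_self[OF chart_at_in_atlas chart_at_covers])

lemma endo_rep_chart_at: "endo_rep A (chart_at A p) r (chart_map (chart_at A p) p) = r p"
  by (rule blinfun_eqI) (simp add: endo_rep_def chart_inv_chart_map[OF chart_at_in_atlas chart_at_covers]
      jacobian_self[OF chart_at_in_atlas chart_at_covers])

lemma vec_rep_endo:
  fixes r :: "('a, 'e) endo_field"
  assumes "c \<in> A" "x \<in> chart_map c ` (U \<inter> chart_dom c)"
  shows "vec_rep A c (\<lambda>q. r q (X q)) x = endo_rep A c r x (vec_rep A c X x)"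
  using assms by (auto simp: vec_rep_def endo_rep_def Let_def chart_inv_chart_map jacobian_inverse)

lemma cov_rep_dual_map:
  fixes r :: "('a, 'e) endo_field"
  assumes "c \<in> A" "x \<in> chart_map c ` (U \<inter> chart_dom c)"
  shows "cov_rep A c (\<lambda>q. dual_map (r q) (\<alpha> q)) x = cov_rep A c \<alpha> x o\<^sub>L endo_rep A c r x"
  using assms
  by (auto intro!: blinfun_eqI simp: cov_rep_def endo_rep_def dual_map_def Let_def chart_inv_chart_map jacobian_inverse)

lemma smooth_vec_on_endo:
  fixes r :: "('a, 'e) endo_field"
  assumes "smooth_endo A r" "open U" "smooth_vec_on A U X"
  shows "smooth_vec_on A U (\<lambda>q. r q (X q))"
  unfolding smooth_vec_on_def
proof
  fix c assume c: "c \<in> A"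
  let ?S = "chart_map c ` (U \<inter> chart_dom c)"
  have S: "open ?S" using open_chart_image[OF c assms(2)] .
  have "smooth_on ?S (endo_rep A c r)"
    using assms(1) c smooth_on_subset[of _ _ ?S] unfolding smooth_endo_def by blast
  moreover have "smooth_on ?S (vec_rep A c X)" using assms(3) c unfolding smooth_vec_on_def by blast
  ultimately have "smooth_on ?S (\<lambda>x. endo_rep A c r x (vec_rep A c X x))"
    by (rule smooth_on_bounded_bilinear[OF S bounded_bilinear_blinfun_apply])
  then show "smooth_on ?S (vec_rep A c (\<lambda>q. r q (X q)))"
    by (rule smooth_on_cong[OF S, rotated]) (simp add: vec_rep_endo[OF c])
qed

lemma smooth_form_on_dual_map:
  fixes r :: "('a, 'e) endo_field"
  assumes "smooth_endo A r" "open U" "smooth_form_on A U \<alpha>"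
  shows "smooth_form_on A U (\<lambda>q. dual_map (r q) (\<alpha> q))"
  unfolding smooth_form_on_def
proof
  fix c assume c: "c \<in> A"
  let ?S = "chart_map c ` (U \<inter> chart_dom c)"
  have S: "open ?S" using open_chart_image[OF c assms(2)] .
  have "smooth_on ?S (endo_rep A c r)"
    using assms(1) c smooth_on_subset[of _ _ ?S] unfolding smooth_endo_def by blast
  moreover have "smooth_on ?S (cov_rep A c \<alpha>)" using assms(3) c unfolding smooth_form_on_def by blast
  ultimately have "smooth_on ?S (\<lambda>x. cov_rep A c \<alpha> x o\<^sub>L endo_rep A c r x)"
    by (intro smooth_on_bounded_bilinear[OF S bounded_bilinear_blinfun_compose])
  then show "smooth_on ?S (cov_rep A c (\<lambda>q. dual_map (r q) (\<alpha> q)))"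
    by (rule smooth_on_cong[OF S, rotated]) (simp add: cov_rep_dual_map[OF c])
qed

section \<open>Derivatives at a point in the distinguished chart\<close>

text \<open>
  The coordinate derivative of \<open>r\<close> is not a tensor, but all formulas below are identities in
  one fixed chart, in which the terms with \<open>endo_deriv\<close> combine or cancel.
\<close>

definition endo_deriv :: "('a, 'e) endo_field \<Rightarrow> 'a \<Rightarrow> 'e \<Rightarrow> 'e \<Rightarrow>\<^sub>L 'e" where
  "endo_deriv r p =
     frechet_derivative (endo_rep A (chart_at A p) r) (at (chart_map (chart_at A p) p))"

lemma vec_deriv_works:
  assumes "smooth_vec_on A UNIV X"
  shows "(vec_rep A (chart_at A p) X has_derivative vec_deriv A X p) (at (chart_map (chart_at A p) p))"
  unfolding vec_deriv_def frechet_derivative_works[symmetric]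
  using assms chart_at_in_atlas chart_at_covers
  by (auto simp: smooth_vec_on_def intro!: smooth_on_differentiable)

lemma form_deriv_works:
  assumes "smooth_form_on A UNIV \<alpha>"
  shows "(cov_rep A (chart_at A p) \<alpha> has_derivative form_deriv A \<alpha> p) (at (chart_map (chart_at A p) p))"
  unfolding form_deriv_def frechet_derivative_works[symmetric]
  using assms chart_at_in_atlas chart_at_covers
  by (auto simp: smooth_form_on_def intro!: smooth_on_differentiable)

lemma endo_deriv_works:
  assumes "smooth_endo A r"
  shows "(endo_rep A (chart_at A p) r has_derivative endo_deriv r p) (at (chart_map (chart_at A p) p))"
  unfolding endo_deriv_def frechet_derivative_works[symmetric]
  using assms chart_at_in_atlas chart_at_covers
  by (auto simp: smooth_endo_def intro!: smooth_on_differentiable)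

lemma vec_deriv_linear: "smooth_vec_on A UNIV X \<Longrightarrow> bounded_linear (vec_deriv A X p)"
  using vec_deriv_works has_derivative_bounded_linear by blast

lemma form_deriv_linear: "smooth_form_on A UNIV \<alpha> \<Longrightarrow> bounded_linear (form_deriv A \<alpha> p)"
  using form_deriv_works has_derivative_bounded_linear by blast

lemma chart_at_nbhd:
  "open (chart_map (chart_at A p) ` (UNIV \<inter> chart_dom (chart_at A p)))"
  "chart_map (chart_at A p) p \<in> chart_map (chart_at A p) ` (UNIV \<inter> chart_dom (chart_at A p))"
  using open_chart_image[OF chart_at_in_atlas, of UNIV] chart_at_covers by auto

lemma vec_deriv_endo:
  fixes r :: "('a, 'e) endo_field"
  assumes "smooth_endo A r" "smooth_vec_on A UNIV X"
  shows "vec_deriv A (\<lambda>q. r q (X q)) p v = endo_deriv r p v (X p) + r p (vec_deriv A X p v)"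
proof -
  let ?c = "chart_at A p" and ?x = "chart_map (chart_at A p) p"
  have "((\<lambda>x. endo_rep A ?c r x (vec_rep A ?c X x)) has_derivative
      (\<lambda>v. r p (vec_deriv A X p v) + endo_deriv r p v (X p))) (at ?x)"
    using bounded_bilinear.FDERIV[OF bounded_bilinear_blinfun_apply
        endo_deriv_works[OF assms(1), of p] vec_deriv_works[OF assms(2)]]
    by (simp add: vec_rep_chart_at endo_rep_chart_at)
  then have "(vec_rep A ?c (\<lambda>q. r q (X q)) has_derivative
      (\<lambda>v. r p (vec_deriv A X p v) + endo_deriv r p v (X p))) (at ?x)"
    by (rule has_derivative_transform_within_open[OF _ chart_at_nbhd])
       (simp add: vec_rep_endo[OF chart_at_in_atlas, of _ p UNIV])
  from has_derivative_unique[OF this vec_deriv_works[OF smooth_vec_on_endo[OF assms(1) open_UNIV assms(2)]]]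
  show ?thesis by (metis add.commute)
qed

lemma form_deriv_dual_map:
  fixes r :: "('a, 'e) endo_field"
  assumes "smooth_endo A r" "smooth_form_on A UNIV \<alpha>"
  shows "form_deriv A (\<lambda>q. dual_map (r q) (\<alpha> q)) p v w
    = form_deriv A \<alpha> p v (r p w) + \<alpha> p (endo_deriv r p v w)"
proof -
  let ?c = "chart_at A p" and ?x = "chart_map (chart_at A p) p"
  have "((\<lambda>x. cov_rep A ?c \<alpha> x o\<^sub>L endo_rep A ?c r x) has_derivative
      (\<lambda>v. (\<alpha> p o\<^sub>L endo_deriv r p v) + (form_deriv A \<alpha> p v o\<^sub>L r p))) (at ?x)"
    using bounded_bilinear.FDERIV[OF bounded_bilinear_blinfun_compose
        form_deriv_works[OF assms(2), of p] endo_deriv_works[OF assms(1)]]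
    by (simp add: cov_rep_chart_at endo_rep_chart_at)
  then have "(cov_rep A ?c (\<lambda>q. dual_map (r q) (\<alpha> q)) has_derivative
      (\<lambda>v. (\<alpha> p o\<^sub>L endo_deriv r p v) + (form_deriv A \<alpha> p v o\<^sub>L r p))) (at ?x)"
    by (rule has_derivative_transform_within_open[OF _ chart_at_nbhd])
       (simp add: cov_rep_dual_map[OF chart_at_in_atlas, of _ p UNIV])
  from has_derivative_unique[OF this form_deriv_works[OF smooth_form_on_dual_map[OF assms(1) open_UNIV assms(2)]]]
  have "form_deriv A (\<lambda>q. dual_map (r q) (\<alpha> q)) p = (\<lambda>v. (\<alpha> p o\<^sub>L endo_deriv r p v) + (form_deriv A \<alpha> p v o\<^sub>L r p))"
    by simp
  then show ?thesis by (simp add: blinfun.add_left)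
qed

lemma lie_deriv_apply:
  assumes "smooth_vec_on A UNIV X"
  shows "lie_deriv A X \<beta> p v = form_deriv A \<beta> p (X p) v + \<beta> p (vec_deriv A X p v)"
  unfolding lie_deriv_def
  by (subst bounded_linear_Blinfun_apply)
     (auto intro!: bounded_linear_add bounded_linear_compose[OF _ vec_deriv_linear[OF assms]] blinfun.bounded_linear_right)

lemma interior_prod_ext_deriv_apply:
  assumes "smooth_form_on A UNIV \<alpha>"
  shows "interior_prod Y (ext_deriv A \<alpha>) p v = form_deriv A \<alpha> p (Y p) v - form_deriv A \<alpha> p v (Y p)"
  unfolding interior_prod_def ext_deriv_def
  by (subst bounded_linear_Blinfun_apply)
     (auto intro!: bounded_linear_sub bounded_linear_compose[OF bounded_linear_apply_blinfun form_deriv_linear[OF assms]]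
        blinfun.bounded_linear_right)

section \<open>Extending a tangent vector to a vector field\<close>

text \<open>
  The compatibility and Nijenhuis conditions quantify over globally defined vector fields, and
  identities of covectors are tested on a single tangent vector; this lemma connects the two.  A
  constant coordinate field is cut off by a bump function with support in a closed coordinate ball.
  The image \<open>K\<close> of this ball in the manifold is compact, hence closed as the manifold is Hausdorff,
  so that the extension by \<open>0\<close> is smooth near the points outside the chart as well.
\<close>

lemma vec_extension:
  obtains Z where "smooth_vec_on A UNIV Z" "Z p = v"
proof -
  define c where "c = chart_at A p"
  have c: "c \<in> A" "p \<in> chart_dom c" using chart_at_in_atlas chart_at_covers by (auto simp: c_def)
  let ?D = "chart_map c ` (UNIV \<inter> chart_dom c)"
  have "open ?D" "chart_map c p \<in> ?D" using open_chart_image[OF c(1), of UNIV] c(2) by auto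
  then obtain R where R: "R > 0" "cball (chart_map c p) R \<subseteq> ?D"
    using open_contains_cball by blast
  obtain \<phi> :: "'e \<Rightarrow> real" where \<phi>: "smooth_on UNIV \<phi>" "\<phi> (chart_map c p) = 1"
      "\<And>y. y \<notin> ball (chart_map c p) R \<Longrightarrow> \<phi> y = 0"
    using smooth_bump[OF R(1)] by blast
  define K where "K = chart_inv c ` cball (chart_map c p) R"
  have "compact K" unfolding K_def
  proof (rule compact_continuous_image)
    show "continuous_on (cball (chart_map c p) R) (chart_inv c)"
      by (rule continuous_on_subset[OF homeomorphism_cont2[OF chart_homeomorphism[OF c(1)]]])
         (use R(2) in simp)
  qed simp
  then have K: "open (- K)" using compact_imp_closed by auto
  define Z where "Z q = (if q \<in> chart_dom c
      then jacobian c (chart_at A q) q (\<phi> (chart_map c q) *\<^sub>R v) else 0)" for q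
  have Z0: "Z q = 0" if "q \<notin> K" for q
  proof (cases "q \<in> chart_dom c")
    case True
    have "chart_map c q \<notin> ball (chart_map c p) R"
    proof
      assume "chart_map c q \<in> ball (chart_map c p) R"
      then have "chart_inv c (chart_map c q) \<in> K" unfolding K_def by (intro imageI) auto
      then show False using that chart_inv_chart_map[OF c(1) True] by simp
    qed
    then show ?thesis using \<phi>(3) by (simp add: Z_def)
  qed (simp add: Z_def)
  have "smooth_vec_on A UNIV Z" unfolding smooth_vec_on_def
  proof (intro ballI smooth_on_open_local)
    fix d x assume d: "d \<in> A" and "x \<in> chart_map d ` (UNIV \<inter> chart_dom d)"
    then obtain q where q: "q \<in> chart_dom d" "x = chart_map d q" by auto
    show "\<exists>T. open T \<and> x \<in> T \<and> smooth_on T (vec_rep A d Z)"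
    proof (cases "q \<in> chart_dom c")
      case True
      let ?T = "chart_map d ` (chart_dom c \<inter> chart_dom d)"
      let ?T' = "chart_map c ` (chart_dom d \<inter> chart_dom c)"
      let ?\<tau> = "chart_map c \<circ> chart_inv d" and ?\<tau>' = "chart_map d \<circ> chart_inv c"
      have T: "open ?T" "open ?T'" using open_chart_image open_chart_dom c d by auto
      have \<tau>: "smooth_on ?T ?\<tau>" "smooth_on ?T' ?\<tau>'"
        using transition_smooth[OF d c(1)] transition_smooth[OF c(1) d] by (simp_all add: Int_commute)
      have "smooth_on ?T' (\<lambda>y. \<phi> y *\<^sub>R frechet_derivative ?\<tau>' (at y) v)"
        by (intro smooth_on_scaleR smooth_on_directional_derivative T \<tau> smooth_on_subset[OF \<phi>(1)]) simp
      then have "smooth_on ?T (\<lambda>x. \<phi> (?\<tau> x) *\<^sub>R frechet_derivative ?\<tau>' (at (?\<tau> x)) v)"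
        by (rule smooth_on_compose[OF T _ \<tau>(1), rotated]) (use c d in \<open>auto simp: chart_inv_chart_map\<close>)
      then have "smooth_on ?T (vec_rep A d Z)"
      proof (rule smooth_on_cong[OF T(1), rotated])
        fix x assume "x \<in> ?T"
        then obtain q where q: "q \<in> chart_dom c" "q \<in> chart_dom d" "x = chart_map d q" by auto
        have rep: "vec_rep A d Z x = jacobian c d q (\<phi> (chart_map c q) *\<^sub>R v)"
          using q d c chart_at_in_atlas chart_at_covers
          by (simp add: vec_rep_def chart_inv_chart_map Z_def jacobian_cocycle)
        have jac: "frechet_derivative ?\<tau>' (at (chart_map c q)) = blinfun_apply (jacobian c d q)"
          using frechet_derivative_at[OF transition_has_derivative[OF c(1) d q(1,2)]] by simp
        show "\<phi> (?\<tau> x) *\<^sub>R frechet_derivative ?\<tau>' (at (?\<tau> x)) v = vec_rep A d Z x"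
          unfolding rep using q d by (simp add: chart_inv_chart_map jac blinfun.scaleR_right)
      qed
      then show ?thesis using T(1) True q by blast
    next
      case False
      let ?T = "chart_map d ` (- K \<inter> chart_dom d)"
      have "K \<subseteq> chart_dom c" using R(2) c(1) by (auto simp: K_def chart_inv_chart_map dest!: subsetD)
      then have "x \<in> ?T" using False q by blast
      moreover have "open ?T" using open_chart_image[OF d K] .
      moreover have "smooth_on ?T (vec_rep A d Z)"
        by (rule smooth_on_cong[OF \<open>open ?T\<close> _ smooth_on_const[of _ 0]])
           (use d in \<open>auto simp: vec_rep_def chart_inv_chart_map Z0\<close>)
      ultimately show ?thesis by blast
    qed
  qed
  moreover have "Z p = v"
    using c \<phi>(2) jacobian_self[OF c] by (simp add: Z_def c_def)
  ultimately show thesis by (rule that)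
qed

end

section \<open>Linear algebra of Lagrangian subspaces\<close>

text \<open>
  A covector is replaced by the vector representing it, which turns the fibres of the generalised
  tangent bundle into a Euclidean space and gives access to inner products and dimension formulas.
\<close>

definition riesz_pair :: "'e::euclidean_space gen_vec \<Rightarrow> 'e \<times> 'e" where
  "riesz_pair u = (fst u, \<Sum>b\<in>Basis. snd u b *\<^sub>R b)"

lemma riesz_inner:
  fixes \<alpha> :: "'e::euclidean_space \<Rightarrow>\<^sub>L real"
  shows "(\<Sum>b\<in>Basis. \<alpha> b *\<^sub>R b) \<bullet> x = blinfun_apply \<alpha> x"
proof -
  have "\<alpha> x = \<alpha> (\<Sum>b\<in>Basis. (x \<bullet> b) *\<^sub>R b)" by (simp add: euclidean_representation)
  also have "\<dots> = (\<Sum>b\<in>Basis. (x \<bullet> b) *\<^sub>R \<alpha> b)"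
    by (simp only: blinfun.sum_right blinfun.scaleR_right)
  finally show ?thesis
    by (simp add: inner_sum_left inner_commute[of x] mult.commute)
qed

lemma riesz_pair_bounded_linear: "bounded_linear (riesz_pair :: 'e::euclidean_space gen_vec \<Rightarrow> 'e \<times> 'e)"
  unfolding riesz_pair_def
  by (intro bounded_linear_Pair bounded_linear_fst bounded_linear_sum
      bounded_linear_compose[OF bounded_linear_scaleR_left]
      bounded_linear_compose[OF blinfun.bounded_linear_left] bounded_linear_snd)

lemma riesz_pair_inj: "inj riesz_pair"
proof (rule injI)
  fix u w :: "'a gen_vec" assume eq: "riesz_pair u = riesz_pair w"
  have "snd u x = snd w x" for x
    using eq riesz_inner[of "snd u" x] riesz_inner[of "snd w" x] by (simp add: riesz_pair_def)
  then show "u = w" using eq by (auto simp: riesz_pair_def prod_eq_iff intro: blinfun_eqI)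
qed

lemma riesz_pair_surj: "surj riesz_pair"
proof (rule surjI)
  fix y :: "'a \<times> 'a"
  show "riesz_pair (fst y, blinfun_inner_left (snd y)) = y"
    by (simp add: riesz_pair_def euclidean_representation inner_commute[of _ "snd y"])
qed

lemma pairing_riesz: "pairing u w = riesz_pair u \<bullet> prod.swap (riesz_pair w)"
  by (simp add: pairing_def riesz_pair_def riesz_inner inner_commute[of "fst u"] add.commute)

text \<open>
  The pairing is the inner product twisted by exchanging the two components, so the pairing
  complement has the dimension of the orthogonal complement.
\<close>

lemma pairing_perp_dim:
  fixes S :: "'e::euclidean_space gen_vec set"
  assumes "subspace S"
  shows "dim (riesz_pair ` {w. \<forall>u\<in>S. pairing w u = 0}) + dim (riesz_pair ` S) = 2 * DIM('e)"
proof -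
  let ?J = "riesz_pair :: 'e gen_vec \<Rightarrow> 'e \<times> 'e"
  have swap: "linear (prod.swap :: 'e \<times> 'e \<Rightarrow> 'e \<times> 'e)" by (rule linearI) auto
  have J: "linear ?J" using riesz_pair_bounded_linear bounded_linear.linear by blast
  let ?P = "{y. \<forall>x\<in>?J ` S. orthogonal x y}"
  have "?J ` {w. \<forall>u\<in>S. pairing w u = 0} = prod.swap ` ?P"
  proof (intro equalityI subsetI)
    fix y assume "y \<in> prod.swap ` ?P"
    then obtain z where z: "z \<in> ?P" "y = prod.swap z" by blast
    obtain w where w: "y = ?J w" using riesz_pair_surj by (metis surjD)
    have "pairing w u = 0" if "u \<in> S" for u
    proof -
      have "?J u \<bullet> prod.swap (?J w) = 0" using z that by (simp add: w[symmetric] orthogonal_def)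
      then show ?thesis by (metis pairing_riesz pairing_def add.commute)
    qed
    then show "y \<in> ?J ` {w. \<forall>u\<in>S. pairing w u = 0}" using w by blast
  next
    fix y assume "y \<in> ?J ` {w. \<forall>u\<in>S. pairing w u = 0}"
    then obtain w where w: "y = ?J w" "\<And>u. u \<in> S \<Longrightarrow> pairing w u = 0" by blast
    have "?J u \<bullet> prod.swap y = 0" if "u \<in> S" for u
      using w(2)[OF that] pairing_riesz[of u w] by (simp add: w(1) pairing_def add.commute)
    then have "prod.swap y \<in> ?P" by (simp add: orthogonal_def)
    from imageI[OF this, of prod.swap] show "y \<in> prod.swap ` ?P" by simp
  qed
  moreover have "dim (prod.swap ` ?P) = dim ?P"
    by (rule dim_image_eq[OF swap]) simp
  ultimately have "dim (?J ` {w. \<forall>u\<in>S. pairing w u = 0}) = dim ?P" by (simp only:)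
  moreover have "dim {y \<in> UNIV. \<forall>x \<in> ?J ` S. orthogonal x y} + dim (?J ` S) = dim (UNIV :: ('e \<times> 'e) set)"
    by (rule dim_subspace_orthogonal_to_vectors) (auto intro: linear_subspace_image[OF J assms])
  ultimately show ?thesis by simp
qed

lemma subspace_pairing_perp: "subspace {w. \<forall>u\<in>S. pairing w u = 0}"
proof (rule subspaceI)
  have add: "pairing (v + w) u = pairing v u + pairing w u"
    and scale: "pairing (c *\<^sub>R w) u = c * pairing w u"
    for u v w :: "'a gen_vec" and c
    by (simp_all add: pairing_def blinfun.bilinear_simps distrib_left)
  show "0 \<in> {w. \<forall>u\<in>S. pairing w u = 0}" by (simp add: pairing_def)
  show "v + w \<in> {w. \<forall>u\<in>S. pairing w u = 0}"
    if "v \<in> {w. \<forall>u\<in>S. pairing w u = 0}" "w \<in> {w. \<forall>u\<in>S. pairing w u = 0}" for v w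
    using that by (simp add: add)
  show "c *\<^sub>R w \<in> {w. \<forall>u\<in>S. pairing w u = 0}" if "w \<in> {w. \<forall>u\<in>S. pairing w u = 0}" for c w
    using that by (simp add: scale)
qed

text \<open>
  A subspace equal to its complement for the pairing has half the total dimension.  An injective map
  preserves the dimension, and an isotropic subspace of half the total dimension fills its own
  complement.
\<close>

lemma lagrangian_image:
  fixes L :: "'e::euclidean_space gen_vec set" and T :: "'e gen_vec \<Rightarrow> 'e gen_vec"
  assumes lag: "L = {w. \<forall>u\<in>L. pairing w u = 0}"
    and T: "linear T"
    and inj: "\<And>u. u \<in> L \<Longrightarrow> T u = 0 \<Longrightarrow> u = 0"
    and iso: "\<And>u w. u \<in> L \<Longrightarrow> w \<in> L \<Longrightarrow> pairing (T u) (T w) = 0"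
  shows "T ` L = {w. \<forall>u\<in>T ` L. pairing w u = 0}"
proof -
  let ?J = "riesz_pair :: 'e gen_vec \<Rightarrow> 'e \<times> 'e" and ?Q = "{w. \<forall>u\<in>T ` L. pairing w u = 0}"
  have J: "linear ?J" using riesz_pair_bounded_linear bounded_linear.linear by blast
  have subL: "subspace L" using subspace_pairing_perp[of L] lag by simp
  have subTL: "subspace (T ` L)" using linear_subspace_image[OF T subL] .
  have dimL: "2 * dim (?J ` L) = 2 * DIM('e)"
    using pairing_perp_dim[OF subL] lag by simp
  \<comment> \<open>The dimension formula for images is applied to \<open>T\<close> transported to the Euclidean model.\<close>
  define G where "G = ?J \<circ> T \<circ> inv ?J"
  have invJ: "linear (inv ?J)"
  proof (rule linearI)
    show "inv ?J (x + y) = inv ?J x + inv ?J y" for x y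
      by (rule inv_f_eq[OF riesz_pair_inj]) (simp add: linear_add[OF J] surj_f_inv_f[OF riesz_pair_surj])
    show "inv ?J (c *\<^sub>R x) = c *\<^sub>R inv ?J x" for c x
      by (rule inv_f_eq[OF riesz_pair_inj]) (simp add: linear_cmul[OF J] surj_f_inv_f[OF riesz_pair_surj])
  qed
  have G: "linear G" unfolding G_def by (intro linear_compose J T invJ)
  have GJ: "G (?J u) = ?J (T u)" for u by (simp add: G_def inv_f_f[OF riesz_pair_inj])
  have "inj_on G (?J ` L)"
  proof -
    have "\<forall>x\<in>?J ` L. G x = 0 \<longrightarrow> x = 0"
    proof (intro ballI impI)
      fix x assume "x \<in> ?J ` L" and x0: "G x = 0"
      then obtain u where u: "u \<in> L" "x = ?J u" by blast
      have "?J (T u) = ?J 0" using x0 by (simp add: u GJ linear_0[OF J])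
      then have "T u = 0" by (rule injD[OF riesz_pair_inj])
      then show "x = 0" using inj[OF u(1)] by (simp add: u linear_0[OF J])
    qed
    then show ?thesis
      using linear_inj_on_iff_eq_0[OF G linear_subspace_image[OF J subL]] by blast
  qed
  then have "dim (G ` ?J ` L) = dim (?J ` L)"
    using dim_image_eq[OF G] linear_subspace_image[OF J subL] by (metis span_eq_iff)
  then have "dim (?J ` T ` L) = dim (?J ` L)" by (simp add: image_image GJ)
  then have "dim (?J ` ?Q) \<le> dim (?J ` T ` L)"
    using pairing_perp_dim[OF subTL] dimL by simp
  moreover have "?J ` T ` L \<subseteq> ?J ` ?Q" using iso by auto
  ultimately have "?J ` T ` L = ?J ` ?Q"
    by (intro subspace_dim_equal linear_subspace_image[OF J] subTL subspace_pairing_perp)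
  then show ?thesis by (simp only: inj_image_eq_iff[OF riesz_pair_inj])
qed

section \<open>Images of a subbundle under a fibrewise injective map\<close>

lemma frame_sum_eq_0:
  assumes "inj_on f {..<k::nat}" "independent (f ` {..<k})" "(\<Sum>i<k. a i *\<^sub>R f i) = 0"
  shows "\<forall>i<k. a i = 0"
proof -
  define b where "b v = a (the_inv_into {..<k} f v)" for v
  have "(\<Sum>v\<in>f ` {..<k}. b v *\<^sub>R v) = 0"
    using assms(1,3) by (simp add: sum.reindex b_def the_inv_into_f_f)
  then have "b v = 0" if "v \<in> f ` {..<k}" for v
    using independentD[OF assms(2), of "f ` {..<k}" b v] that by simp
  then show ?thesis using assms(1) by (force simp: b_def the_inv_into_f_f)
qed

lemma frame_span_sum:
  assumes "inj_on f {..<k::nat}" "v \<in> span (f ` {..<k})"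
  shows "\<exists>a. v = (\<Sum>i<k. a i *\<^sub>R f i)"
proof -
  obtain b where "v = (\<Sum>w\<in>f ` {..<k}. b w *\<^sub>R w)"
    using assms(2) by (auto simp: span_finite)
  then show ?thesis using assms(1) by (auto simp: sum.reindex)
qed

definition local_frame ::
  "('a, 'e::euclidean_space) chart set \<Rightarrow> ('a \<Rightarrow> 'e gen_vec set) \<Rightarrow> nat \<Rightarrow> 'a set
    \<Rightarrow> (nat \<Rightarrow> ('a, 'e) gen_section) \<Rightarrow> bool" where
  "local_frame A L k U e \<longleftrightarrow> (\<forall>i<k. smooth_gen_on A U (e i)) \<and>
     (\<forall>q\<in>U. inj_on (\<lambda>i. e i q) {..<k} \<and> independent ((\<lambda>i. e i q) ` {..<k}) \<and>
            span ((\<lambda>i. e i q) ` {..<k}) = L q)"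

lemma smooth_subbundle_iff_local_frame:
  "smooth_subbundle A L \<longleftrightarrow> (\<exists>k. \<forall>p. \<exists>U e. open U \<and> p \<in> U \<and> local_frame A L k U e)"
  unfolding smooth_subbundle_def local_frame_def ..

lemma local_frameD:
  assumes "local_frame A L k U e"
  shows "i < k \<Longrightarrow> smooth_gen_on A U (e i)"
    and "q \<in> U \<Longrightarrow> inj_on (\<lambda>i. e i q) {..<k}"
    and "q \<in> U \<Longrightarrow> independent ((\<lambda>i. e i q) ` {..<k})"
    and "q \<in> U \<Longrightarrow> span ((\<lambda>i. e i q) ` {..<k}) = L q"
  using assms unfolding local_frame_def by simp_all

text \<open>
  Joining the two components makes the coefficients in a frame of generalised vectors accessible
  to \<open>smooth_coefficients\<close>.
\<close>

definition gen_rep ::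
  "('a, 'e::euclidean_space) chart set \<Rightarrow> ('a, 'e) chart \<Rightarrow> ('a, 'e) gen_section \<Rightarrow> 'e \<Rightarrow> 'e gen_vec" where
  "gen_rep A c \<sigma> x = (vec_rep A c (\<lambda>p. fst (\<sigma> p)) x, cov_rep A c (\<lambda>p. snd (\<sigma> p)) x)"

context
  fixes A :: "('a::{t2_space,second_countable_topology}, 'e::euclidean_space) chart set"
  assumes atlas: "smooth_atlas A"
begin

lemma smooth_gen_on_iff_gen_rep:
  assumes "open U"
  shows "smooth_gen_on A U \<sigma> \<longleftrightarrow> (\<forall>c\<in>A. smooth_on (chart_map c ` (U \<inter> chart_dom c)) (gen_rep A c \<sigma>))"
  unfolding smooth_gen_on_def smooth_vec_on_def smooth_form_on_def gen_rep_def
  using smooth_on_Pair_iff[OF open_chart_image[OF atlas _ assms]] by blast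

lemma gen_rep_cong: "\<sigma> (chart_inv c x) = \<tau> (chart_inv c x) \<Longrightarrow> gen_rep A c \<sigma> x = gen_rep A c \<tau> x"
  by (simp add: gen_rep_def vec_rep_def cov_rep_def)

lemma gen_rep_scaleR: "gen_rep A c (\<lambda>p. a *\<^sub>R \<sigma> p) x = a *\<^sub>R gen_rep A c \<sigma> x"
  by (auto intro!: blinfun_eqI simp: gen_rep_def vec_rep_def cov_rep_def Let_def blinfun.bilinear_simps)

lemma gen_rep_add: "gen_rep A c (\<lambda>p. \<sigma> p + \<tau> p) x = gen_rep A c \<sigma> x + gen_rep A c \<tau> x"
  by (auto intro!: blinfun_eqI simp: gen_rep_def vec_rep_def cov_rep_def Let_def blinfun.bilinear_simps)

lemma gen_rep_sum: "gen_rep A c (\<lambda>p. \<Sum>i<k. a i *\<^sub>R \<sigma> i p) x = (\<Sum>i<k. a i *\<^sub>R gen_rep A c (\<sigma> i) x)" for k :: nat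
proof (induction k)
  case 0
  show ?case
    by (auto intro!: blinfun_eqI simp: gen_rep_def vec_rep_def cov_rep_def Let_def zero_prod_def blinfun.bilinear_simps)
qed (simp add: gen_rep_add gen_rep_scaleR)

text \<open>
  Changing charts is invertible in each fibre, so independence of a frame can be tested in any chart.
\<close>

lemma gen_rep_eq_0:
  assumes "c \<in> A" "p \<in> chart_dom c" "gen_rep A c \<sigma> (chart_map c p) = 0"
  shows "\<sigma> p = 0"
proof -
  let ?k = "chart_at A p"
  have v: "jacobian ?k c p (fst (\<sigma> p)) = 0" and f: "snd (\<sigma> p) o\<^sub>L jacobian c ?k p = 0"
    using assms by (auto simp: gen_rep_def vec_rep_def cov_rep_def chart_inv_chart_map[OF atlas] zero_prod_def)
  have "fst (\<sigma> p) = 0"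
    using jacobian_inverse(1)[OF atlas assms(1,2), of "fst (\<sigma> p)"] v by simp
  moreover have "snd (\<sigma> p) w = 0" for w
    using jacobian_inverse(1)[OF atlas assms(1,2), of w] f
    by (metis blinfun_apply_blinfun_compose blinfun.zero_left)
  ultimately show ?thesis by (auto simp: prod_eq_iff intro: blinfun_eqI)
qed

lemma smooth_gen_on_diff:
  assumes "open U" "smooth_gen_on A U \<sigma>" "smooth_gen_on A U \<tau>"
  shows "smooth_gen_on A U (\<lambda>p. \<sigma> p - \<tau> p)"
proof -
  have "gen_rep A c (\<lambda>p. \<sigma> p - \<tau> p) = (\<lambda>x. gen_rep A c \<sigma> x - gen_rep A c \<tau> x)" for c
    using gen_rep_add[of c \<sigma> "\<lambda>p. (-1) *\<^sub>R \<tau> p"] gen_rep_scaleR[of c "-1" \<tau>] by auto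
  then show ?thesis
    using assms(2,3) unfolding smooth_gen_on_iff_gen_rep[OF assms(1)]
    by (auto intro: smooth_on_diff open_chart_image[OF atlas _ assms(1)])
qed

text \<open>
  Locally \<open>\<sigma>\<close> is a combination \<open>\<Sum> a\<^sub>i e\<^sub>i\<close> of a smooth frame of \<open>L\<close>, with coefficients of unknown
  regularity.  By injectivity of \<open>T\<close> on \<open>L\<close> the sections \<open>T e\<^sub>i\<close> are still independent, and the
  same \<open>a\<^sub>i\<close> are the coefficients of the smooth section \<open>T \<sigma>\<close> with respect to them; hence they are
  smooth.
\<close>

lemma smooth_lift:
  assumes sub: "smooth_subbundle A L"
    and lin: "\<And>p. linear (T p :: 'e gen_vec \<Rightarrow> 'e gen_vec)"
    and smooth: "\<And>U \<sigma>. open U \<Longrightarrow> smooth_gen_on A U \<sigma> \<Longrightarrow> smooth_gen_on A U (\<lambda>q. T q (\<sigma> q))"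
    and inj: "\<And>p u. u \<in> L p \<Longrightarrow> T p u = 0 \<Longrightarrow> u = 0"
    and mem: "\<And>p. \<sigma> p \<in> L p"
    and T\<sigma>: "smooth_gen_on A UNIV (\<lambda>p. T p (\<sigma> p))"
  shows "smooth_gen_on A UNIV \<sigma>"
  unfolding smooth_gen_on_iff_gen_rep[OF open_UNIV]
proof (intro ballI smooth_on_open_local)
  fix c x assume c: "c \<in> A" and "x \<in> chart_map c ` (UNIV \<inter> chart_dom c)"
  then obtain q where q: "q \<in> chart_dom c" "x = chart_map c q" by blast
  obtain k U e where U: "open U" "q \<in> U" and e_frame: "local_frame A L k U e"
    using sub unfolding smooth_subbundle_iff_local_frame by blast
  note e = local_frameD(1)[OF e_frame] and frame = local_frameD(2-4)[OF e_frame]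
  have "\<exists>a. \<sigma> p = (\<Sum>i<k. a i *\<^sub>R e i p)" if "p \<in> U" for p
    using frame_span_sum[OF frame(1)[OF that]] frame(3)[OF that] mem by blast
  then obtain a where a: "\<And>p. p \<in> U \<Longrightarrow> \<sigma> p = (\<Sum>i<k. a p i *\<^sub>R e i p)" by metis
  let ?V = "chart_map c ` (U \<inter> chart_dom c)"
  have V: "open ?V" using open_chart_image[OF atlas c U(1)] .
  have inV: "chart_inv c y \<in> U" "chart_inv c y \<in> chart_dom c" "chart_map c (chart_inv c y) = y" if "y \<in> ?V" for y
    using that by (auto simp: chart_inv_chart_map[OF atlas c])
  define F where "F i y = riesz_pair (gen_rep A c (\<lambda>p. T p (e i p)) y)" for i y
  have J: "linear (riesz_pair :: 'e gen_vec \<Rightarrow> _)"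
    using riesz_pair_bounded_linear bounded_linear.linear by blast
  have Tsum: "T p (\<Sum>i<k. b i *\<^sub>R e i p) = (\<Sum>i<k. b i *\<^sub>R T p (e i p))" for p b
    by (simp add: linear_sum[OF lin] linear_cmul[OF lin])
  have F_sum: "(\<Sum>i<k. b i *\<^sub>R F i y) = riesz_pair (gen_rep A c (\<lambda>p. T p (\<Sum>i<k. b i *\<^sub>R e i p)) y)" for b y
    unfolding Tsum gen_rep_sum F_def by (simp add: linear_sum[OF J] linear_cmul[OF J])
  have "\<forall>i<k. smooth_on ?V (\<lambda>y. a (chart_inv c y) i)"
  proof (rule smooth_coefficients[OF V, of k F])
    show "smooth_on ?V (F i)" if "i < k" for i
      using smooth[OF U(1) e[OF that]] c unfolding F_def smooth_gen_on_iff_gen_rep[OF U(1)]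
      by (intro smooth_on_bounded_linear[OF V riesz_pair_bounded_linear]) blast
  next
    fix y b assume y: "y \<in> ?V" and "(\<Sum>i<k. b i *\<^sub>R F i y) = 0"
    let ?p = "chart_inv c y"
    have "riesz_pair (gen_rep A c (\<lambda>p. T p (\<Sum>i<k. b i *\<^sub>R e i p)) y) = riesz_pair 0"
      using \<open>(\<Sum>i<k. b i *\<^sub>R F i y) = 0\<close> by (simp add: F_sum linear_0[OF J])
    then have "gen_rep A c (\<lambda>p. T p (\<Sum>i<k. b i *\<^sub>R e i p)) y = 0"
      by (rule injD[OF riesz_pair_inj])
    then have "T ?p (\<Sum>i<k. b i *\<^sub>R e i ?p) = 0"
      using gen_rep_eq_0[OF c inV(2)[OF y], of "\<lambda>p. T p (\<Sum>i<k. b i *\<^sub>R e i p)"] inV(3)[OF y] by simp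
    moreover have "(\<Sum>i<k. b i *\<^sub>R e i ?p) \<in> L ?p"
      unfolding frame(3)[OF inV(1)[OF y], symmetric]
      by (intro span_sum span_scale span_base) auto
    ultimately have "(\<Sum>i<k. b i *\<^sub>R e i ?p) = 0" using inj by blast
    then show "\<forall>i<k. b i = 0"
      using frame_sum_eq_0[OF frame(1,2)[OF inV(1)[OF y]]] by blast
  next
    have "smooth_on (chart_map c ` (UNIV \<inter> chart_dom c)) (gen_rep A c (\<lambda>p. T p (\<sigma> p)))"
      using T\<sigma> c unfolding smooth_gen_on_iff_gen_rep[OF open_UNIV] by blast
    then have "smooth_on ?V (\<lambda>y. riesz_pair (gen_rep A c (\<lambda>p. T p (\<sigma> p)) y))"
      by (intro smooth_on_bounded_linear[OF V riesz_pair_bounded_linear]) (erule smooth_on_subset, blast)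
    then show "smooth_on ?V (\<lambda>y. \<Sum>i<k. a (chart_inv c y) i *\<^sub>R F i y)"
      unfolding F_sum
      by (rule smooth_on_cong[OF V, rotated]) (auto intro!: arg_cong[where f = riesz_pair] gen_rep_cong simp: a inV)
  qed
  then have "smooth_on ?V (\<lambda>y. \<Sum>i<k. a (chart_inv c y) i *\<^sub>R gen_rep A c (e i) y)"
    using e c unfolding smooth_gen_on_iff_gen_rep[OF U(1)]
    by (intro smooth_on_sum smooth_on_scaleR V) auto
  then have "smooth_on ?V (gen_rep A c \<sigma>)"
    unfolding gen_rep_sum[symmetric]
    by (rule smooth_on_cong[OF V, rotated]) (auto intro!: gen_rep_cong simp: a inV)
  then show "\<exists>T. open T \<and> x \<in> T \<and> smooth_on T (gen_rep A c \<sigma>)" using V U(2) q by blast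
qed

lemma smooth_subbundle_image:
  assumes sub: "smooth_subbundle A L"
    and lin: "\<And>p. linear (T p :: 'e gen_vec \<Rightarrow> 'e gen_vec)"
    and smooth: "\<And>U \<sigma>. open U \<Longrightarrow> smooth_gen_on A U \<sigma> \<Longrightarrow> smooth_gen_on A U (\<lambda>q. T q (\<sigma> q))"
    and inj: "\<And>p u. u \<in> L p \<Longrightarrow> T p u = 0 \<Longrightarrow> u = 0"
  shows "smooth_subbundle A (\<lambda>p. T p ` L p)"
proof -
  obtain k where k: "\<And>p. \<exists>U e. open U \<and> p \<in> U \<and> local_frame A L k U e"
    using sub unfolding smooth_subbundle_iff_local_frame by blast
  show ?thesis unfolding smooth_subbundle_iff_local_frame
  proof (intro exI[of _ k] allI)
    fix p
    obtain U e where U: "open U" "p \<in> U" and e_frame: "local_frame A L k U e"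
      using k by blast
    note e = local_frameD(1)[OF e_frame] and frame = local_frameD(2-4)[OF e_frame]
    have "inj_on (\<lambda>i. T q (e i q)) {..<k} \<and> independent ((\<lambda>i. T q (e i q)) ` {..<k}) \<and>
        span ((\<lambda>i. T q (e i q)) ` {..<k}) = T q ` L q" if q: "q \<in> U" for q
    proof -
      let ?B = "(\<lambda>i. e i q) ` {..<k}"
      have "subspace (span ?B)" by simp
      then have injL: "inj_on (T q) (span ?B)"
        using linear_inj_on_iff_eq_0[OF lin] inj frame(3)[OF q] by blast
      have im: "(\<lambda>i. T q (e i q)) ` {..<k} = T q ` ?B" by (simp add: image_image)
      have "inj_on (T q \<circ> (\<lambda>i. e i q)) {..<k}"
        using frame(1)[OF q] inj_on_subset[OF injL span_superset] by (rule comp_inj_on)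
      moreover have "independent (T q ` ?B)"
        using linear_independent_injective_image[OF lin frame(2)[OF q] injL] .
      moreover have "span (T q ` ?B) = T q ` L q"
        using linear_span_image[OF lin] frame(3)[OF q] by metis
      ultimately show ?thesis unfolding im by (simp add: o_def)
    qed
    then have "local_frame A (\<lambda>p. T p ` L p) k U (\<lambda>i q. T q (e i q))"
      using smooth[OF U(1) e] unfolding local_frame_def by simp
    then show "\<exists>U e. open U \<and> p \<in> U \<and> local_frame A (\<lambda>p. T p ` L p) k U e" using U by blast
  qed
qed

section \<open>Images of a Dirac-Nijenhuis structure\<close>

text \<open>
  The part of the argument common to both families.  By injectivity of \<open>T\<close> on \<open>L\<close> and
  \<open>smooth_lift\<close> the sections of \<open>T L\<close> are exactly the \<open>T \<sigma>\<close> with \<open>\<sigma>\<close> a section of \<open>L\<close>, so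
  each closure condition for \<open>T L\<close> follows as soon as the operation in question, applied to
  sections \<open>T \<sigma>\<close>, is \<open>T\<close> of a section of \<open>L\<close>.
\<close>

lemma dirac_nijenhuis_image:
  fixes r :: "('a, 'e) endo_field"
  assumes DN: "dirac_nijenhuis A L r"
    and lin: "\<And>p. linear (T p :: 'e gen_vec \<Rightarrow> 'e gen_vec)"
    and smooth: "\<And>U \<sigma>. open U \<Longrightarrow> smooth_gen_on A U \<sigma> \<Longrightarrow> smooth_gen_on A U (\<lambda>q. T q (\<sigma> q))"
    and inj: "\<And>p u. u \<in> L p \<Longrightarrow> T p u = 0 \<Longrightarrow> u = 0"
    and iso: "\<And>p u w. u \<in> L p \<Longrightarrow> w \<in> L p \<Longrightarrow> pairing (T p u) (T p w) = 0"
    and comm: "\<And>p u. map_prod (r p) (dual_map (r p)) (T p u) = T p (map_prod (r p) (dual_map (r p)) u)"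
    and D: "\<And>X \<sigma>. smooth_vec_on A UNIV X \<Longrightarrow> \<sigma> \<in> sections A L \<Longrightarrow>
      D_gen A r X (\<lambda>q. T q (\<sigma> q)) = (\<lambda>q. T q (D_gen A r X \<sigma> q))"
    and bracket: "\<And>\<sigma> \<tau>. \<sigma> \<in> sections A L \<Longrightarrow> \<tau> \<in> sections A L \<Longrightarrow>
      \<exists>\<rho>\<in>sections A L. courant_dorfman A (\<lambda>q. T q (\<sigma> q)) (\<lambda>q. T q (\<tau> q)) = (\<lambda>q. T q (\<rho> q))"
  shows "dirac_nijenhuis A (\<lambda>p. T p ` L p) r"
proof -
  have dirac: "dirac_structure A L" and r: "smooth_endo A r" "nijenhuis A r" and comp: "compatible A L r"
    using DN unfolding dirac_nijenhuis_def by auto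
  have sub: "smooth_subbundle A L" and lag: "\<And>p. L p = {w. \<forall>u\<in>L p. pairing w u = 0}"
    using dirac unfolding dirac_structure_def by auto
  have sections: "sections A (\<lambda>p. T p ` L p) = (\<lambda>\<sigma> q. T q (\<sigma> q)) ` sections A L"
  proof (intro equalityI subsetI)
    fix \<sigma>' assume s: "\<sigma>' \<in> sections A (\<lambda>p. T p ` L p)"
    then have "\<forall>p. \<exists>u. u \<in> L p \<and> \<sigma>' p = T p u" unfolding sections_def by blast
    then obtain \<sigma> where \<sigma>: "\<And>p. \<sigma> p \<in> L p" "\<And>p. \<sigma>' p = T p (\<sigma> p)" by metis
    then have eq: "\<sigma>' = (\<lambda>p. T p (\<sigma> p))" by blast
    have "smooth_gen_on A UNIV \<sigma>"
      using s unfolding eq sections_def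
      by (intro smooth_lift[of L T, OF sub lin smooth inj \<sigma>(1)]) auto
    then show "\<sigma>' \<in> (\<lambda>\<sigma> q. T q (\<sigma> q)) ` sections A L"
      using \<sigma>(1) unfolding eq sections_def by blast
  next
    fix \<sigma>' assume "\<sigma>' \<in> (\<lambda>\<sigma> q. T q (\<sigma> q)) ` sections A L"
    then show "\<sigma>' \<in> sections A (\<lambda>p. T p ` L p)" using smooth[OF open_UNIV] by (auto simp: sections_def)
  qed
  have "dirac_structure A (\<lambda>p. T p ` L p)"
    unfolding dirac_structure_def
  proof (intro conjI allI)
    show "smooth_subbundle A (\<lambda>p. T p ` L p)"
      by (rule smooth_subbundle_image[OF sub lin smooth inj])
    show "T p ` L p = {w. \<forall>u\<in>T p ` L p. pairing w u = 0}" for p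
      by (rule lagrangian_image[OF lag lin inj iso])
    show "\<forall>\<sigma>\<in>sections A (\<lambda>p. T p ` L p). \<forall>\<tau>\<in>sections A (\<lambda>p. T p ` L p).
        courant_dorfman A \<sigma> \<tau> \<in> sections A (\<lambda>p. T p ` L p)"
      unfolding sections using bracket by (auto simp: image_iff)
  qed
  moreover have "compatible A (\<lambda>p. T p ` L p) r"
    unfolding compatible_def
  proof (intro conjI allI impI)
    show "map_prod (r p) (dual_map (r p)) ` T p ` L p \<subseteq> T p ` L p" for p
      using comp comm unfolding compatible_def by (auto simp: image_subset_iff)
    show "D_gen A r X ` sections A (\<lambda>p. T p ` L p) \<subseteq> sections A (\<lambda>p. T p ` L p)"
      if "smooth_vec_on A UNIV X" for X
      using comp that D[OF that] unfolding compatible_def sections by (auto simp: image_subset_iff)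
  qed
  ultimately show ?thesis using r unfolding dirac_nijenhuis_def by blast
qed

lemma dual_map_apply: "dual_map s \<alpha> v = \<alpha> (s v)"
  by (simp add: dual_map_def)

lemma sectionsD:
  assumes "\<sigma> \<in> sections A L"
  shows "smooth_vec_on A UNIV (\<lambda>q. fst (\<sigma> q))" "smooth_form_on A UNIV (\<lambda>q. snd (\<sigma> q))" "\<sigma> p \<in> L p"
  using assms by (auto simp: sections_def smooth_gen_on_def)

text \<open>
  This identity between \<open>D\<^sup>r\<close> and \<open>r\<close> is the Nijenhuis condition for \<open>Y\<close> and \<open>X\<close>,
  rearranged.
\<close>

lemma D_vec_endo:
  fixes r :: "('a, 'e) endo_field"
  assumes "nijenhuis A r" "smooth_vec_on A UNIV X" "smooth_vec_on A UNIV Y"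
  shows "D_vec A r X (\<lambda>q. r q (Y q)) p = r p (D_vec A r X Y p)"
  using assms unfolding nijenhuis_def D_vec_def
  by (simp add: blinfun.bilinear_simps algebra_simps eq_diff_eq)

text \<open>
  The dual identity: evaluated on a tangent vector \<open>Z\<close>, the difference of the two sides is
  \<open>- \<beta>(N(X, Z))\<close>, where \<open>N\<close> is the Nijenhuis torsion of \<open>r\<close>.
\<close>

lemma D_form_dual_map:
  fixes r :: "('a, 'e) endo_field"
  assumes "nijenhuis A r" "smooth_endo A r" "smooth_vec_on A UNIV X" "smooth_form_on A UNIV \<beta>"
  shows "D_form A r X (\<lambda>q. dual_map (r q) (\<beta> q)) p = dual_map (r p) (D_form A r X \<beta> p)"
proof (rule blinfun_eqI)
  fix v
  obtain Z where Z: "smooth_vec_on A UNIV Z" "Z p = v" using vec_extension[OF atlas] .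
  let ?rX = "\<lambda>q. r q (X q)" and ?rZ = "\<lambda>q. r q (Z q)"
  note vec = smooth_vec_on_endo[OF atlas assms(2) open_UNIV]
  note form = smooth_form_on_dual_map[OF atlas assms(2) open_UNIV]
  have "lie_bracket A ?rX ?rZ p - r p (lie_bracket A ?rX Z p + lie_bracket A X ?rZ p - r p (lie_bracket A X Z p)) = 0"
    using assms(1,3) Z(1) unfolding nijenhuis_def by blast
  then have "\<beta> p (lie_bracket A ?rX ?rZ p - r p (lie_bracket A ?rX Z p + lie_bracket A X ?rZ p
      - r p (lie_bracket A X Z p))) = 0" by simp
  then show "D_form A r X (\<lambda>q. dual_map (r q) (\<beta> q)) p v = dual_map (r p) (D_form A r X \<beta> p) v"
    by (simp add: D_form_def lie_deriv_apply[OF atlas] vec form assms Z form_deriv_dual_map[OF atlas]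
        vec_deriv_endo[OF atlas] dual_map_apply lie_bracket_def blinfun.bilinear_simps)
qed

text \<open>
  For sections \<open>\<sigma> = (X, \<alpha>)\<close> and \<open>\<tau> = (Y, \<beta>)\<close> of \<open>L\<close> put
  \<open>\<rho> = [[\<sigma>, (r, r\<^sup>*) \<tau>]] - D\<^sub>X \<tau>\<close>, which is a section of \<open>L\<close> by compatibility.  The terms
  \<open>L\<^sub>X(r\<^sup>*\<beta>)\<close> cancel, so its form part is \<open>L\<^bsub>rX\<^esub> \<beta> - i\<^bsub>rY\<^esub> d\<alpha>\<close>, and its vector part is
  \<open>[rX, Y] + [X, rY] - r[X, Y]\<close>, which \<open>r\<close> maps to \<open>[rX, rY]\<close> by the Nijenhuis condition.  Thus
  \<open>(r, id) \<rho> = [[(r, id) \<sigma>, (r, id) \<tau>]]\<close>.  Isotropy of the image holds as \<open>(r, id)\<close> and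
  \<open>(id, r\<^sup>*)\<close> are adjoint for the pairing, with product \<open>(r, r\<^sup>*)\<close>, which preserves \<open>L\<close>.
\<close>

lemma dirac_nijenhuis_vec_image:
  fixes r :: "('a, 'e) endo_field"
  assumes DN: "dirac_nijenhuis A L r"
    and inj: "\<And>p u. u \<in> L p \<Longrightarrow> map_prod (r p) id u = 0 \<Longrightarrow> u = 0"
  shows "dirac_nijenhuis A (\<lambda>p. map_prod (r p) id ` L p) r"
proof (rule dirac_nijenhuis_image[OF DN])
  have dirac: "dirac_structure A L" and r: "smooth_endo A r" and nij: "nijenhuis A r"
    and comp: "compatible A L r"
    using DN unfolding dirac_nijenhuis_def by auto
  have inv: "map_prod (r p) (dual_map (r p)) u \<in> L p" if "u \<in> L p" for p u
    using comp that unfolding compatible_def by blast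
  have DL: "D_gen A r X \<sigma> \<in> sections A L" if "smooth_vec_on A UNIV X" "\<sigma> \<in> sections A L" for X \<sigma>
    using comp that unfolding compatible_def by blast
  show "linear (map_prod (r p) id)" for p
    by (rule linearI) (auto simp: blinfun.bilinear_simps map_prod_def split: prod.splits)
  show "smooth_gen_on A U (\<lambda>q. map_prod (r q) id (\<sigma> q))" if "open U" "smooth_gen_on A U \<sigma>" for U \<sigma>
    using that smooth_vec_on_endo[OF atlas r] by (simp add: smooth_gen_on_def)
  show "u = 0" if "u \<in> L p" "map_prod (r p) id u = 0" for p u using inj that .
  show "pairing (map_prod (r p) id u) (map_prod (r p) id w) = 0" if "u \<in> L p" "w \<in> L p" for p u w
  proof -
    have "pairing u (map_prod (r p) (dual_map (r p)) w) = 0"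
      using dirac that(1) inv[OF that(2)] unfolding dirac_structure_def by blast
    then show ?thesis by (simp add: pairing_def dual_map_def)
  qed
  show "map_prod (r p) (dual_map (r p)) (map_prod (r p) id u) = map_prod (r p) id (map_prod (r p) (dual_map (r p)) u)" for p u
    by (cases u) simp
  show "D_gen A r X (\<lambda>q. map_prod (r q) id (\<sigma> q)) = (\<lambda>q. map_prod (r q) id (D_gen A r X \<sigma> q))"
    if "smooth_vec_on A UNIV X" "\<sigma> \<in> sections A L" for X \<sigma>
    using D_vec_endo[OF nij that(1) sectionsD(1)[OF that(2)]] by (simp add: D_gen_def fun_eq_iff)
  show "\<exists>\<rho>\<in>sections A L. courant_dorfman A (\<lambda>q. map_prod (r q) id (\<sigma> q)) (\<lambda>q. map_prod (r q) id (\<tau> q))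
      = (\<lambda>q. map_prod (r q) id (\<rho> q))" if s: "\<sigma> \<in> sections A L" "\<tau> \<in> sections A L" for \<sigma> \<tau>
  proof
    define X where "X = (\<lambda>q. fst (\<sigma> q))"
    define Y where "Y = (\<lambda>q. fst (\<tau> q))"
    have X: "smooth_vec_on A UNIV X" and Y: "smooth_vec_on A UNIV Y"
      using sectionsD(1)[OF s(1)] sectionsD(1)[OF s(2)] by (simp_all add: X_def Y_def)
    define \<tau>' where "\<tau>' q = map_prod (r q) (dual_map (r q)) (\<tau> q)" for q
    define \<rho> where "\<rho> = (\<lambda>q. courant_dorfman A \<sigma> \<tau>' q - D_gen A r X \<tau> q)"
    have "\<tau>' \<in> sections A L"
      using s(2) inv smooth_vec_on_endo[OF atlas r open_UNIV] smooth_form_on_dual_map[OF atlas r open_UNIV]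
      by (simp add: sections_def \<tau>'_def smooth_gen_on_def)
    then have cd: "courant_dorfman A \<sigma> \<tau>' \<in> sections A L"
      using dirac s(1) unfolding dirac_structure_def by blast
    have subL: "subspace (L p)" for p
      using dirac subspace_pairing_perp[of "L p"] unfolding dirac_structure_def by metis
    show "\<rho> \<in> sections A L"
      using cd DL[OF X s(2)] smooth_gen_on_diff[OF open_UNIV] subspace_diff[OF subL]
      by (simp add: sections_def \<rho>_def)
    show "courant_dorfman A (\<lambda>q. map_prod (r q) id (\<sigma> q)) (\<lambda>q. map_prod (r q) id (\<tau> q))
      = (\<lambda>q. map_prod (r q) id (\<rho> q))"
    proof
      fix p
      have "lie_bracket A (\<lambda>q. r q (X q)) (\<lambda>q. r q (Y q)) p
            - r p (lie_bracket A (\<lambda>q. r q (X q)) Y p + lie_bracket A X (\<lambda>q. r q (Y q)) p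
                   - r p (lie_bracket A X Y p)) = 0"
        using nij X Y unfolding nijenhuis_def by blast
      moreover have "fst (\<rho> p) = lie_bracket A (\<lambda>q. r q (X q)) Y p + lie_bracket A X (\<lambda>q. r q (Y q)) p
                   - r p (lie_bracket A X Y p)"
        unfolding \<rho>_def courant_dorfman_def D_gen_def D_vec_def \<tau>'_def Let_def X_def Y_def
        by (simp add: lie_bracket_def blinfun.bilinear_simps)
      moreover have "snd (\<rho> p) = lie_deriv A (\<lambda>q. r q (X q)) (\<lambda>q. snd (\<tau> q)) p
          - interior_prod (\<lambda>q. r q (Y q)) (ext_deriv A (\<lambda>q. snd (\<sigma> q))) p"
        unfolding \<rho>_def courant_dorfman_def D_gen_def D_form_def \<tau>'_def Let_def X_def Y_def by simp
      ultimately show "courant_dorfman A (\<lambda>q. map_prod (r q) id (\<sigma> q)) (\<lambda>q. map_prod (r q) id (\<tau> q)) p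
          = map_prod (r p) id (\<rho> p)"
        by (simp add: courant_dorfman_def Let_def X_def Y_def prod_eq_iff)
    qed
  qed
qed

text \<open>
  The bracket satisfies \<open>[[(id, r\<^sup>*) \<sigma>, (id, r\<^sup>*) \<tau>]] = (id, r\<^sup>*) [[\<sigma>, \<tau>]]\<close> for sections
  \<open>\<sigma> = (X, \<alpha>)\<close> and \<open>\<tau> = (Y, \<beta>)\<close> of \<open>L\<close>.  The vector parts agree trivially.  The difference of
  the form parts, evaluated on a vector field \<open>Z\<close>, is the pairing of \<open>D\<^sub>Z \<sigma>\<close> with \<open>\<tau>\<close>, and it
  vanishes since both are sections of the isotropic bundle \<open>L\<close>.
\<close>

lemma dirac_nijenhuis_form_image:
  fixes r :: "('a, 'e) endo_field"
  assumes DN: "dirac_nijenhuis A L r"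
    and inj: "\<And>p u. u \<in> L p \<Longrightarrow> map_prod id (dual_map (r p)) u = 0 \<Longrightarrow> u = 0"
  shows "dirac_nijenhuis A (\<lambda>p. map_prod id (dual_map (r p)) ` L p) r"
proof (rule dirac_nijenhuis_image[OF DN])
  have dirac: "dirac_structure A L" and r: "smooth_endo A r" and nij: "nijenhuis A r"
    and comp: "compatible A L r"
    using DN unfolding dirac_nijenhuis_def by auto
  have inv: "map_prod (r p) (dual_map (r p)) u \<in> L p" if "u \<in> L p" for p u
    using comp that unfolding compatible_def by blast
  have DL: "D_gen A r X \<sigma> \<in> sections A L" if "smooth_vec_on A UNIV X" "\<sigma> \<in> sections A L" for X \<sigma>
    using comp that unfolding compatible_def by blast
  have isoL: "pairing u w = 0" if "u \<in> L p" "w \<in> L p" for p u w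
    using dirac that unfolding dirac_structure_def by blast
  show "linear (map_prod id (dual_map (r p)))" for p
    by (rule linearI)
       (auto intro!: blinfun_eqI simp: dual_map_def blinfun.bilinear_simps map_prod_def split: prod.splits)
  show "smooth_gen_on A U (\<lambda>q. map_prod id (dual_map (r q)) (\<sigma> q))" if "open U" "smooth_gen_on A U \<sigma>" for U \<sigma>
    using that smooth_form_on_dual_map[OF atlas r] by (simp add: smooth_gen_on_def)
  show "u = 0" if "u \<in> L p" "map_prod id (dual_map (r p)) u = 0" for p u using inj that .
  show "pairing (map_prod id (dual_map (r p)) u) (map_prod id (dual_map (r p)) w) = 0" if "u \<in> L p" "w \<in> L p" for p u w
    using isoL[OF that(1) inv[OF that(2)]] by (simp add: pairing_def dual_map_def)
  show "map_prod (r p) (dual_map (r p)) (map_prod id (dual_map (r p)) u)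
      = map_prod id (dual_map (r p)) (map_prod (r p) (dual_map (r p)) u)" for p u
    by (cases u) simp
  show "D_gen A r X (\<lambda>q. map_prod id (dual_map (r q)) (\<sigma> q)) = (\<lambda>q. map_prod id (dual_map (r q)) (D_gen A r X \<sigma> q))"
    if "smooth_vec_on A UNIV X" "\<sigma> \<in> sections A L" for X \<sigma>
    using D_form_dual_map[OF nij r that(1) sectionsD(2)[OF that(2)]] by (simp add: D_gen_def fun_eq_iff)
  show "\<exists>\<rho>\<in>sections A L. courant_dorfman A (\<lambda>q. map_prod id (dual_map (r q)) (\<sigma> q))
      (\<lambda>q. map_prod id (dual_map (r q)) (\<tau> q)) = (\<lambda>q. map_prod id (dual_map (r q)) (\<rho> q))"
    if s: "\<sigma> \<in> sections A L" "\<tau> \<in> sections A L" for \<sigma> \<tau>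
  proof
    show "courant_dorfman A \<sigma> \<tau> \<in> sections A L"
      using dirac s unfolding dirac_structure_def by blast
    define X where "X = (\<lambda>q. fst (\<sigma> q))"
    define Y where "Y = (\<lambda>q. fst (\<tau> q))"
    define \<alpha> where "\<alpha> = (\<lambda>q. snd (\<sigma> q))"
    define \<beta> where "\<beta> = (\<lambda>q. snd (\<tau> q))"
    have X: "smooth_vec_on A UNIV X" and Y: "smooth_vec_on A UNIV Y"
      and \<alpha>: "smooth_form_on A UNIV \<alpha>" and \<beta>: "smooth_form_on A UNIV \<beta>"
      using sectionsD[OF s(1)] sectionsD[OF s(2)] by (simp_all add: X_def Y_def \<alpha>_def \<beta>_def)
    note vec = smooth_vec_on_endo[OF atlas r open_UNIV]
    note form = smooth_form_on_dual_map[OF atlas r open_UNIV]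
    have "(lie_deriv A X (\<lambda>q. dual_map (r q) (\<beta> q)) p
          - interior_prod Y (ext_deriv A (\<lambda>q. dual_map (r q) (\<alpha> q))) p) v
        = dual_map (r p) (lie_deriv A X \<beta> p - interior_prod Y (ext_deriv A \<alpha>) p) v" for p v
    proof -
      obtain Z where Z: "smooth_vec_on A UNIV Z" "Z p = v" using vec_extension[OF atlas] .
      have "pairing (D_gen A r Z \<sigma> p) (\<tau> p) = 0"
        by (intro isoL[of _ p] sectionsD(3) DL Z s)
      then have "\<beta> p (D_vec A r Z X p) + D_form A r Z \<alpha> p (Y p) = 0"
        by (simp add: pairing_def D_gen_def X_def Y_def \<alpha>_def \<beta>_def)
      then show ?thesis
        by (simp add: D_form_def D_vec_def lie_deriv_apply[OF atlas] interior_prod_ext_deriv_apply[OF atlas]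
          vec form X \<alpha> Z r form_deriv_dual_map[OF atlas] \<beta>
          vec_deriv_endo[OF atlas] dual_map_apply lie_bracket_def blinfun.bilinear_simps)
    qed
    then have "lie_deriv A X (\<lambda>q. dual_map (r q) (\<beta> q)) p
          - interior_prod Y (ext_deriv A (\<lambda>q. dual_map (r q) (\<alpha> q))) p
        = dual_map (r p) (lie_deriv A X \<beta> p - interior_prod Y (ext_deriv A \<alpha>) p)" for p
      by (rule blinfun_eqI)
    then show "courant_dorfman A (\<lambda>q. map_prod id (dual_map (r q)) (\<sigma> q))
      (\<lambda>q. map_prod id (dual_map (r q)) (\<tau> q)) = (\<lambda>q. map_prod id (dual_map (r q)) (courant_dorfman A \<sigma> \<tau> q))"
      by (simp add: courant_dorfman_def Let_def fun_eq_iff X_def Y_def \<alpha>_def \<beta>_def)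
  qed
qed

text \<open>
  The kernel condition is carried along in the induction.  If \<open>w = (X, \<alpha>)\<close> lies in the bundle and
  \<open>(r, id)\<close> kills \<open>(r, id) w = (rX, \<alpha>)\<close>, then \<open>\<alpha> = 0\<close>; hence \<open>(rX, \<alpha>) = (r, r\<^sup>*) w\<close> lies in the
  bundle again, and the kernel condition there gives \<open>(rX, \<alpha>) = 0\<close>.
\<close>

lemma dirac_nijenhuis_L_vec:
  fixes r :: "('a, 'e) endo_field"
  assumes DN: "dirac_nijenhuis A L r"
    and inj: "\<And>p u. u \<in> L p \<Longrightarrow> map_prod (r p) id u = 0 \<Longrightarrow> u = 0"
  shows "dirac_nijenhuis A (L_vec r n L) r \<and> (\<forall>p. \<forall>u\<in>L_vec r n L p. map_prod (r p) id u = 0 \<longrightarrow> u = 0)"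
proof (induction n)
  case 0
  have "L_vec r 0 L = L" by (rule ext) (simp add: L_vec_def prod.map_id0)
  then show ?case using assms by auto
next
  case (Suc n)
  let ?M = "L_vec r n L"
  have step: "L_vec r (Suc n) L = (\<lambda>p. map_prod (r p) id ` ?M p)"
    by (rule ext) (simp add: L_vec_def image_comp map_prod.comp)
  have ker: "\<And>p u. u \<in> ?M p \<Longrightarrow> map_prod (r p) id u = 0 \<Longrightarrow> u = 0" using Suc by blast
  have "map_prod (r p) id w = 0" if w: "w \<in> ?M p" and z: "map_prod (r p) id (map_prod (r p) id w) = 0" for p w
  proof -
    have snd: "snd w = 0"
      using z by (auto simp: zero_prod_def map_prod_def split: prod.splits)
    have "map_prod (r p) (dual_map (r p)) w \<in> ?M p"
      using Suc w unfolding dirac_nijenhuis_def compatible_def by blast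
    moreover have "map_prod (r p) (dual_map (r p)) w = map_prod (r p) id w"
      using snd by (auto simp: prod_eq_iff dual_map_def)
    ultimately show ?thesis using ker z by metis
  qed
  then show ?case
    using dirac_nijenhuis_vec_image[of ?M r, OF conjunct1[OF Suc] ker] unfolding step by auto
qed

text \<open>
  As before: if \<open>(id, r\<^sup>*)\<close> kills \<open>(id, r\<^sup>*) w\<close>, then the vector part of \<open>w\<close> is zero, and so
  \<open>(id, r\<^sup>*) w = (r, r\<^sup>*) w\<close> lies in the bundle again.
\<close>

lemma dirac_nijenhuis_L_form:
  fixes r :: "('a, 'e) endo_field"
  assumes DN: "dirac_nijenhuis A L r"
    and inj: "\<And>p u. u \<in> L p \<Longrightarrow> map_prod id (dual_map (r p)) u = 0 \<Longrightarrow> u = 0"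
  shows "dirac_nijenhuis A (L_form r n L) r \<and>
    (\<forall>p. \<forall>u\<in>L_form r n L p. map_prod id (dual_map (r p)) u = 0 \<longrightarrow> u = 0)"
proof (induction n)
  case 0
  have "L_form r 0 L = L" by (rule ext) (simp add: L_form_def prod.map_id0)
  then show ?case using assms by auto
next
  case (Suc n)
  let ?M = "L_form r n L"
  have step: "L_form r (Suc n) L = (\<lambda>p. map_prod id (dual_map (r p)) ` ?M p)"
    by (rule ext) (simp add: L_form_def image_comp map_prod.comp)
  have ker: "\<And>p u. u \<in> ?M p \<Longrightarrow> map_prod id (dual_map (r p)) u = 0 \<Longrightarrow> u = 0" using Suc by blast
  have "map_prod id (dual_map (r p)) w = 0"
    if w: "w \<in> ?M p" and z: "map_prod id (dual_map (r p)) (map_prod id (dual_map (r p)) w) = 0" for p w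
  proof -
    have fst: "fst w = 0"
      using z by (auto simp: zero_prod_def map_prod_def split: prod.splits)
    have "map_prod (r p) (dual_map (r p)) w \<in> ?M p"
      using Suc w unfolding dirac_nijenhuis_def compatible_def by blast
    moreover have "map_prod (r p) (dual_map (r p)) w = map_prod id (dual_map (r p)) w"
      using fst by (auto simp: prod_eq_iff)
    ultimately show ?thesis using ker z by metis
  qed
  then show ?case
    using dirac_nijenhuis_form_image[of ?M r, OF conjunct1[OF Suc] ker] unfolding step by auto
qed

end

theorem proposition4p8:
  fixes A :: "('a::{t2_space,second_countable_topology}, 'e::euclidean_space) chart set"
    and L :: "'a \<Rightarrow> ('e \<times> ('e \<Rightarrow>\<^sub>L real)) set"
    and r :: "'a \<Rightarrow> 'e \<Rightarrow>\<^sub>L 'e"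
  assumes "smooth_atlas A"
    and "dirac_nijenhuis A L r"
  shows "((\<forall>p. {u \<in> L p. map_prod (blinfun_apply (r p)) id u = 0} = {0}) \<longrightarrow>
            (\<forall>n::nat. dirac_nijenhuis A (L_vec r n L) r)) \<and>
         ((\<forall>p. {u \<in> L p. map_prod id (dual_map (r p)) u = 0} = {0}) \<longrightarrow>
            (\<forall>n::nat. dirac_nijenhuis A (L_form r n L) r))"
proof (intro conjI impI allI)
  fix n
  assume "\<forall>p. {u \<in> L p. map_prod (blinfun_apply (r p)) id u = 0} = {0}"
  then have "\<And>p u. u \<in> L p \<Longrightarrow> map_prod (r p) id u = 0 \<Longrightarrow> u = 0" by blast
  then show "dirac_nijenhuis A (L_vec r n L) r" using dirac_nijenhuis_L_vec[OF assms] by blast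
next
  fix n
  assume "\<forall>p. {u \<in> L p. map_prod id (dual_map (r p)) u = 0} = {0}"
  then have "\<And>p u. u \<in> L p \<Longrightarrow> map_prod id (dual_map (r p)) u = 0 \<Longrightarrow> u = 0" by blast
  then show "dirac_nijenhuis A (L_form r n L) r" using dirac_nijenhuis_L_form[OF assms] by blast
qed

end
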